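(* Consider the dynamical model with naive learners described in the context. If $\eta T=\Omega(1)$, then there is some $M$-Lipschitz reward function $r$ and some transition matrix $P$ on $\mathcal Q$ with $P(q,q)\ge1-\eta$ for all $q\in\mathcal Q$ such that $$R_T^{\mathrm{naive}}=\Omega(MdT).$$ Here $g(T,\eta)=\Omega(f(T,\eta))$ means that there is a constant $c>0$ such that $f(T,\eta)\le c\,g(T,\eta)$ for all $T$ and $\eta$ under consideration.
   Context: Model. Let $d\ge1$, $\mathcal Q=\{0,1\}^d$, $[d]=\{1,\dots,d\}$; $x^{(i)}$ is the $i$-th component of a vector $x$; $\mathcal P(\mathcal Q)$ is the set of probability distributions on $\mathcal Q$; $\eta\in(0,1)$. The quality process $(Q_t)_{t\ge1}$ is a Markov chain on $\mathcal Q$ with $Q_1\sim\pi_1$, $\pi_1$ uniform on $\mathcal Q$, and $\mathbb P(Q_{t+1}=q'\mid Q_t=q)=P(q,q')$, with $P(q,q)\ge1-\eta$ for all $q$. Consumers $t=1,2,\dots$ have private i.i.d. preferences $\theta_t\in\Theta$ with known distribution, and i.i.d. noises $\varepsilon_t$; the sequences $(\theta_t)$, $(\varepsilon_t)$, $(Q_t)$ are mutually independent. There are a reward function $r:\mathcal Q\times\Theta\to\mathbb R$ and a feedback function $f(q,\theta,\varepsilon)=(f^{(i)}(q^{(i)},\varepsilon,\theta))_{i\in[d]}$ with values in a finite set $\mathcal Z\subset\mathbb R^d$. For $\pi\in\mathcal P(\mathcal Q)$, let $G(z,\pi,q)$ be the probability that the review of a consumer whose belief is $\pi$ equals $z$ when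 the current quality is $q$, where a consumer with belief $\pi$ and preference $\theta$ buys iff $\sum_{q'}\pi(q')r(q',\theta)\ge0$, posts $f(q,\theta,\varepsilon)$ if she buys and $\ast$ otherwise. Let $G(z,\pi)=\mathbb E_{q\sim\pi}[G(z,\pi,q)]$, and let $G^{(i)}(z^{(i)},\pi,q^{(i)})$ be the probability that the $i$-th component of the review equals $z^{(i)}$ when the belief is $\pi$ and the $i$-th quality component is $q^{(i)}$. Naive learners are unaware that the quality can change: their belief satisfies $\pi_1^{\mathrm{naive}}=\pi_1$ and $$\pi^{\mathrm{naive}}_{t+1}(q)=\frac{G(Z_t,\pi^{\mathrm{naive}}_t,q)}{G(Z_t,\pi_t^{\mathrm{naive}})}\,\pi_t^{\mathrm{naive}}(q),$$ where $Z_t$ is the review of consumer $t$, who decides according to $\pi_t^{\mathrm{naive}}$: she buys iff $\sum_{q}\pi_t^{\mathrm{naive}}(q)r(q,\theta_t)\ge0$, then $Z_t=f(Q_t,\theta_t,\varepsilon_t)$; otherwise $Z_t=\ast$. Her utility is $u_t^{\mathrm{naive}}=r(Q_t,\theta_t)\mathbf 1\{\sum_{q}\pi_t^{\mathrm{naive}}(q)r(q,\theta_t)\ge0\}$, and $$R_T^{\mathrm{naive}}=\sum_{t=1}^T\mathbb E\big[r(Q_t,\theta_t)_+-u_t^{\mathrm{naive}}\big],\qquad x_+=\max(x,0).$$ $r$ is $M$-Lipschitz if $|r(q,\theta)-r(q',\theta)|\le M\|q-q'\|_1$ for all $q,q'\in\mathcal Q$, $\theta\in\Theta$. Assumptions in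 force. Purchase guarantee: $r$ is weakly increasing in each $q^{(i)}$, and $\mathbb P(r(q,\theta_t)>0)>0$ for every $q\in\mathcal Q$. Identifiability: for all $i\in[d]$, $\pi\in\mathcal P(\mathcal Q)$, $q^{(i)}$, one has $G^{(i)}(\cdot,\pi,q^{(i)})>0$ on the values taken by the feedback; and for $q^{(i)}\ne q'^{(i)}$ there is $z\in\mathcal Z$ with $G^{(i)}(z^{(i)},\pi,q^{(i)})\ne G^{(i)}(z^{(i)},\pi,q'^{(i)})$. *)

theory Defs
  imports "HOL-Probability.Probability"
begin

text \<open>Vectors in $\mathbb R^d$ are functions on the index set \<open>{1..d}\<close>, extended by
  \<^term>\<open>undefined\<close> elsewhere.\<close>

type_synonym vec = "nat \<Rightarrow> real"

definition cube :: "nat \<Rightarrow> vec set" where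
  "cube d = {1..d} \<rightarrow>\<^sub>E {0, 1}"

definition distributions :: "nat \<Rightarrow> (vec \<Rightarrow> real) set" where
  "distributions d = {\<pi>. (\<forall>q\<in>cube d. 0 \<le> \<pi> q) \<and> (\<Sum>q\<in>cube d. \<pi> q) = 1}"

definition uniform_prior :: "nat \<Rightarrow> vec \<Rightarrow> real" where
  "uniform_prior d q = 1 / real (card (cube d))"

text \<open>The static data. The set of preferences is the space of \<open>pref_law\<close>, and
  \<open>feedback_comp A i x \<epsilon> \<theta>\<close> is $f^{(i)}(x,\varepsilon,\theta)$.\<close>

record ('th, 'e) market =
  quality_dim :: nat
  pref_law :: "'th measure"
  noise_law :: "'e measure"
  reward :: "vec \<Rightarrow> 'th \<Rightarrow> real"
  feedback_comp :: "nat \<Rightarrow> real \<Rightarrow> 'e \<Rightarrow> 'th \<Rightarrow> real"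

abbreviation qualities :: "('th, 'e) market \<Rightarrow> vec set" where
  "qualities A \<equiv> cube (quality_dim A)"

abbreviation type_law :: "('th, 'e) market \<Rightarrow> ('th \<times> 'e) measure" where
  "type_law A \<equiv> pref_law A \<Otimes>\<^sub>M noise_law A"

definition buys :: "('th, 'e) market \<Rightarrow> (vec \<Rightarrow> real) \<Rightarrow> 'th \<Rightarrow> bool" where
  "buys A \<pi> \<theta> \<longleftrightarrow> (\<Sum>q\<in>qualities A. \<pi> q * reward A q \<theta>) \<ge> 0"

definition feedback :: "('th, 'e) market \<Rightarrow> vec \<Rightarrow> 'th \<Rightarrow> 'e \<Rightarrow> vec" where
  "feedback A q \<theta> \<epsilon> = (\<lambda>i\<in>{1..quality_dim A}. feedback_comp A i (q i) \<epsilon> \<theta>)"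

definition feedback_values :: "('th, 'e) market \<Rightarrow> vec set" where
  "feedback_values A =
     {feedback A q \<theta> \<epsilon> | q \<theta> \<epsilon>.
        q \<in> qualities A \<and> \<theta> \<in> space (pref_law A) \<and> \<epsilon> \<in> space (noise_law A)}"

text \<open>The review $\ast$ of a consumer who does not buy is \<^term>\<open>None\<close>.\<close>

definition review ::
  "('th, 'e) market \<Rightarrow> (vec \<Rightarrow> real) \<Rightarrow> vec \<Rightarrow> 'th \<Rightarrow> 'e \<Rightarrow> vec option" where
  "review A \<pi> q \<theta> \<epsilon> = (if buys A \<pi> \<theta> then Some (feedback A q \<theta> \<epsilon>) else None)"

definition G :: "('th, 'e) market \<Rightarrow> vec option \<Rightarrow> (vec \<Rightarrow> real) \<Rightarrow> vec \<Rightarrow> real" where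
  "G A z \<pi> q = \<P>(x in type_law A. review A \<pi> q (fst x) (snd x) = z)"

definition G_mean :: "('th, 'e) market \<Rightarrow> vec option \<Rightarrow> (vec \<Rightarrow> real) \<Rightarrow> real" where
  "G_mean A z \<pi> = (\<Sum>q\<in>qualities A. \<pi> q * G A z \<pi> q)"

text \<open>$G^{(i)}(y,\pi,x)$ for a feedback value \<open>y\<close>; it is a function of the \<open>i\<close>-th quality
  component \<open>x\<close> alone because $f^{(i)}$ is.\<close>

definition G_comp ::
  "('th, 'e) market \<Rightarrow> nat \<Rightarrow> real \<Rightarrow> (vec \<Rightarrow> real) \<Rightarrow> real \<Rightarrow> real" where
  "G_comp A i y \<pi> x =
     \<P>(w in type_law A. buys A \<pi> (fst w) \<and> feedback_comp A i x (snd w) (fst w) = y)"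

definition valid_market :: "('th, 'e) market \<Rightarrow> bool" where
  "valid_market A \<longleftrightarrow>
     quality_dim A \<ge> 1 \<and> prob_space (pref_law A) \<and> prob_space (noise_law A) \<and>
     (\<forall>q\<in>qualities A. reward A q \<in> borel_measurable (pref_law A)) \<and>
     (\<forall>i\<in>{1..quality_dim A}. \<forall>x\<in>{0, 1}.
        (\<lambda>w. feedback_comp A i x (snd w) (fst w)) \<in> borel_measurable (type_law A)) \<and>
     finite (feedback_values A)"

definition lipschitz_reward :: "real \<Rightarrow> ('th, 'e) market \<Rightarrow> bool" where
  "lipschitz_reward M A \<longleftrightarrow>
     (\<forall>q\<in>qualities A. \<forall>q'\<in>qualities A. \<forall>\<theta>\<in>space (pref_law A).
        \<bar>reward A q \<theta> - reward A q' \<theta>\<bar> \<le> M * (\<Sum>i=1..quality_dim A. \<bar>q i - q' i\<bar>))"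

definition purchase_guarantee :: "('th, 'e) market \<Rightarrow> bool" where
  "purchase_guarantee A \<longleftrightarrow>
     (\<forall>\<theta>\<in>space (pref_law A). \<forall>q\<in>qualities A. \<forall>i\<in>{1..quality_dim A}.
        reward A (q(i := 0)) \<theta> \<le> reward A (q(i := 1)) \<theta>) \<and>
     (\<forall>q\<in>qualities A. \<P>(\<theta> in pref_law A. reward A q \<theta> > 0) > 0)"

definition identifiable :: "('th, 'e) market \<Rightarrow> bool" where
  "identifiable A \<longleftrightarrow>
     (\<forall>i\<in>{1..quality_dim A}. \<forall>\<pi>\<in>distributions (quality_dim A).
        (\<forall>x\<in>{0, 1}. \<forall>z\<in>feedback_values A. G_comp A i (z i) \<pi> x > 0) \<and>
        (\<forall>x\<in>{0, 1}. \<forall>x'\<in>{0, 1}. x \<noteq> x' \<longrightarrow>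
           (\<exists>z\<in>feedback_values A. G_comp A i (z i) \<pi> x \<noteq> G_comp A i (z i) \<pi> x')))"

definition transition_matrix :: "nat \<Rightarrow> (vec \<Rightarrow> vec \<Rightarrow> real) \<Rightarrow> bool" where
  "transition_matrix d P \<longleftrightarrow> (\<forall>q\<in>cube d. P q \<in> distributions d)"

text \<open>Time starts at 1 in all the processes below; index 0 carries no meaning.\<close>

definition markov_chain ::
  "nat \<Rightarrow> (vec \<Rightarrow> vec \<Rightarrow> real) \<Rightarrow> 'w measure \<Rightarrow> (nat \<Rightarrow> 'w \<Rightarrow> vec) \<Rightarrow> bool" where
  "markov_chain d P \<Omega> Q \<longleftrightarrow>
     (\<forall>t\<ge>1. Q t \<in> \<Omega> \<rightarrow>\<^sub>M count_space (cube d)) \<and>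
     (\<forall>q\<in>cube d. \<P>(\<omega> in \<Omega>. Q 1 \<omega> = q) = uniform_prior d q) \<and>
     (\<forall>t\<ge>1. \<forall>h. (\<forall>s\<in>{1..Suc t}. h s \<in> cube d) \<longrightarrow>
        \<P>(\<omega> in \<Omega>. \<forall>s\<in>{1..Suc t}. Q s \<omega> = h s) =
        \<P>(\<omega> in \<Omega>. \<forall>s\<in>{1..t}. Q s \<omega> = h s) * P (h t) (h (Suc t)))"

definition iid_sequence :: "'a measure \<Rightarrow> 'w measure \<Rightarrow> (nat \<Rightarrow> 'w \<Rightarrow> 'a) \<Rightarrow> bool" where
  "iid_sequence D \<Omega> X \<longleftrightarrow>
     prob_space.indep_vars \<Omega> (\<lambda>_. D) X {1..} \<and> (\<forall>t\<ge>1. distr \<Omega> D (X t) = D)"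

definition sequence_events :: "'a measure \<Rightarrow> 'w measure \<Rightarrow> (nat \<Rightarrow> 'w \<Rightarrow> 'a) \<Rightarrow> 'w set set" where
  "sequence_events D \<Omega> X =
     sets (vimage_algebra (space \<Omega>) (\<lambda>\<omega>. \<lambda>t\<in>{1..}. X t \<omega>) (PiM {1..} (\<lambda>_. D)))"

text \<open>The list of generated \<open>\<sigma>\<close>-algebras is needed because \<^const>\<open>prob_space.indep_vars\<close> does
  not admit variables of different types.\<close>

definition market_dynamics ::
  "('th, 'e) market \<Rightarrow> (vec \<Rightarrow> vec \<Rightarrow> real) \<Rightarrow> 'w measure \<Rightarrow>
     (nat \<Rightarrow> 'w \<Rightarrow> vec) \<Rightarrow> (nat \<Rightarrow> 'w \<Rightarrow> 'th) \<Rightarrow> (nat \<Rightarrow> 'w \<Rightarrow> 'e) \<Rightarrow> bool" where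
  "market_dynamics A P \<Omega> Q \<theta> \<epsilon> \<longleftrightarrow>
     prob_space \<Omega> \<and>
     markov_chain (quality_dim A) P \<Omega> Q \<and>
     iid_sequence (pref_law A) \<Omega> \<theta> \<and>
     iid_sequence (noise_law A) \<Omega> \<epsilon> \<and>
     prob_space.indep_sets \<Omega>
       (\<lambda>k. [sequence_events (count_space (qualities A)) \<Omega> Q,
             sequence_events (pref_law A) \<Omega> \<theta>,
             sequence_events (noise_law A) \<Omega> \<epsilon>] ! k) {..<3}"

text \<open>The naive belief along given trajectories of qualities, preferences and noises.\<close>

primrec naive_belief ::
  "('th, 'e) market \<Rightarrow> (nat \<Rightarrow> vec) \<Rightarrow> (nat \<Rightarrow> 'th) \<Rightarrow> (nat \<Rightarrow> 'e) \<Rightarrow> nat \<Rightarrow> vec \<Rightarrow> real" where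
  "naive_belief A q \<theta> \<epsilon> 0 = uniform_prior (quality_dim A)"
| "naive_belief A q \<theta> \<epsilon> (Suc t) =
     (if t = 0 then uniform_prior (quality_dim A)
      else let \<pi> = naive_belief A q \<theta> \<epsilon> t; z = review A \<pi> (q t) (\<theta> t) (\<epsilon> t)
           in (\<lambda>k. G A z \<pi> k / G_mean A z \<pi> * \<pi> k))"

definition naive_review ::
  "('th, 'e) market \<Rightarrow> (nat \<Rightarrow> vec) \<Rightarrow> (nat \<Rightarrow> 'th) \<Rightarrow> (nat \<Rightarrow> 'e) \<Rightarrow> nat \<Rightarrow> vec option" where
  "naive_review A q \<theta> \<epsilon> t = review A (naive_belief A q \<theta> \<epsilon> t) (q t) (\<theta> t) (\<epsilon> t)"

definition naive_utility ::
  "('th, 'e) market \<Rightarrow> (nat \<Rightarrow> vec) \<Rightarrow> (nat \<Rightarrow> 'th) \<Rightarrow> (nat \<Rightarrow> 'e) \<Rightarrow> nat \<Rightarrow> real" where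
  "naive_utility A q \<theta> \<epsilon> t =
     reward A (q t) (\<theta> t) * of_bool (buys A (naive_belief A q \<theta> \<epsilon> t) (\<theta> t))"

definition naive_regret ::
  "('th, 'e) market \<Rightarrow> 'w measure \<Rightarrow> (nat \<Rightarrow> 'w \<Rightarrow> vec) \<Rightarrow> (nat \<Rightarrow> 'w \<Rightarrow> 'th) \<Rightarrow>
     (nat \<Rightarrow> 'w \<Rightarrow> 'e) \<Rightarrow> nat \<Rightarrow> real" where
  "naive_regret A \<Omega> Q \<theta> \<epsilon> T =
     (\<Sum>t=1..T. \<integral>\<omega>. (max (reward A (Q t \<omega>) (\<theta> t \<omega>)) 0
        - naive_utility A (\<lambda>s. Q s \<omega>) (\<lambda>s. \<theta> s \<omega>) (\<lambda>s. \<epsilon> s \<omega>) t) \<partial>\<Omega>)"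

text \<open>A naive learner may face a review that has probability 0 under her misspecified belief;
  Bayes' rule is then undefined (and would silently return the zero function, as \<open>x / 0 = 0\<close>).
  The following excludes this almost surely.\<close>

definition naive_update_defined ::
  "('th, 'e) market \<Rightarrow> 'w measure \<Rightarrow> (nat \<Rightarrow> 'w \<Rightarrow> vec) \<Rightarrow> (nat \<Rightarrow> 'w \<Rightarrow> 'th) \<Rightarrow>
     (nat \<Rightarrow> 'w \<Rightarrow> 'e) \<Rightarrow> bool" where
  "naive_update_defined A \<Omega> Q \<theta> \<epsilon> \<longleftrightarrow>
     (AE \<omega> in \<Omega>. \<forall>t\<ge>1.
        G_mean A (naive_review A (\<lambda>s. Q s \<omega>) (\<lambda>s. \<theta> s \<omega>) (\<lambda>s. \<epsilon> s \<omega>) t)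
          (naive_belief A (\<lambda>s. Q s \<omega>) (\<lambda>s. \<theta> s \<omega>) (\<lambda>s. \<epsilon> s \<omega>) t) \<noteq> 0)"

text \<open>\<open>naive_lower_bound d M c S\<close>: some market with an \<open>M\<close>-Lipschitz reward, and for each
  \<open>(T, \<eta>)\<close> in \<open>S\<close> some transition matrix, satisfy $MdT \le c\,R_T^{\mathrm{naive}}$. The regret
  depends only on the joint law of \<open>Q\<close>, \<open>\<theta>\<close>, \<open>\<epsilon>\<close>, so it does not matter which probability space
  carries these processes. Every fixed \<open>d\<close> admits all \<open>T \<ge> 1\<close>, whereas a \<open>c\<close> that is uniform in
  \<open>d\<close> needs \<open>T \<ge> 2\<close>: as $Q_1$ is uniform on the cube, $R_1^{\mathrm{naive}} \le M\sqrt d/2$.\<close>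

definition naive_lower_bound :: "nat \<Rightarrow> real \<Rightarrow> real \<Rightarrow> (nat \<times> real) set \<Rightarrow> bool" where
  "naive_lower_bound d M c S \<longleftrightarrow>
     (\<exists>A :: (real, vec) market.
        quality_dim A = d \<and> valid_market A \<and> lipschitz_reward M A \<and>
        purchase_guarantee A \<and> identifiable A \<and>
        (\<forall>(T, \<eta>)\<in>S. \<exists>P. transition_matrix d P \<and> (\<forall>q\<in>cube d. P q q \<ge> 1 - \<eta>) \<and>
           (\<exists>(\<Omega> :: ((nat \<Rightarrow> vec) \<times> (nat \<Rightarrow> real) \<times> (nat \<Rightarrow> vec)) measure) Q \<theta> \<epsilon>.
              market_dynamics A P \<Omega> Q \<theta> \<epsilon> \<and> naive_update_defined A \<Omega> Q \<theta> \<epsilon> \<and>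
              M * real d * real T \<le> c * naive_regret A \<Omega> Q \<theta> \<epsilon> T)))"

end

theory Submission
  imports Defs
begin

text \<open>The quality chain stays in its uniform initial state for a geometric time of order \<open>T\<close> and then
  jumps to the absorbing best state. Half of the consumers (the high types) always buy; the others
  (the low types) want at least \<open>7d/8\<close> good components in expectation. The feedback flips each
  component independently with probability \<open>1/5\<close>, so the naive posterior is governed by one likelihood
  ratio per component, whose square root is multiplied by \<open>2\<close> or \<open>1/2\<close> at each purchase. For an
  initially bad component the expected square root decays geometrically before the jump and grows
  geometrically after it. Hence for a number of periods proportional to the age of the chain at the
  jump the learners still believe in the old state, in which at least half of the components are
  bad with probability at least \<open>1/2\<close>; then low types do not buy and each of them loses \<open>Md/8\<close>.\<close>

text \<open>The obstacle is that the purchases of low types depend on past reviews, so the number of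
  observed signals is random and correlated with them. High types resolve this: given the
  preferences, each of them supplies a signal for sure, while a low type is bounded by the worse of
  buying and abstaining. Hence the mean evidence is estimated with the preferences held fixed and
  averaged over them afterwards. Only expectations are used, with Markov's inequality applied to the
  sum over components, so no constant depends on \<open>d\<close>.

  A single jump hurts only for a fraction of its age, so the loss is collected over the possible
  jump times: at time t the jump lies within the last seventh of the past with probability of order
  \<rho> t, and summing over t gives \<rho> T^2. The rate \<rho> = min(1/2, 1/C)/T makes this linear
  in T and is admissible because 1 \<le> C \<eta> T forces \<rho> \<le> \<eta>. The case T = 1 is
  separate: no jump has happened yet, and the loss counted there is that of starting in the best
  state, which has probability 2^(-d).\<close>

declare One_nat_def [simp del]

section \<open>The market\<close>

text \<open>With error probability \<open>1/5\<close> the square root of the likelihood ratio of one bit is \<open>2\<close> or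
  \<open>1/2\<close>, hence rational.\<close>

definition bit_noise :: "real pmf" where
  "bit_noise = map_pmf of_bool (bernoulli_pmf (1/5))"

text \<open>Type 1 has a constant positive reward, so it buys under every belief; this yields the
  purchase guarantee and identifiability at all beliefs. The threshold 7/8 is below 1, leaving a low
  type a gain of M/8 per component in the best state, and above the fraction 3/4 that bounds the
  mean in the Markov estimate.\<close>

definition lagging_market :: "nat \<Rightarrow> real \<Rightarrow> (real, vec) market" where
  "lagging_market d M =
     \<lparr>quality_dim = d,
      pref_law = measure_pmf (pmf_of_set {0, 1}),
      noise_law = measure_pmf (Pi_pmf {1..d} 0 (\<lambda>_. bit_noise)),
      reward = (\<lambda>q \<theta>. if \<theta> = 1 then 1 else M * ((\<Sum>i=1..d. q i) - 7/8 * real d)),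
      feedback_comp = (\<lambda>i x \<epsilon> \<theta>. if \<epsilon> i = 1 then 1 - x else x)\<rparr>"

lemma lagging_market_sel [simp]:
  "quality_dim (lagging_market d M) = d"
  "pref_law (lagging_market d M) = measure_pmf (pmf_of_set {0, 1})"
  "noise_law (lagging_market d M) = measure_pmf (Pi_pmf {1..d} 0 (\<lambda>_. bit_noise))"
  "reward (lagging_market d M) q \<theta> =
     (if \<theta> = 1 then 1 else M * ((\<Sum>i=1..d. q i) - 7/8 * real d))"
  "feedback_comp (lagging_market d M) i x \<epsilon> \<theta> = (if \<epsilon> i = 1 then 1 - x else x)"
  by (simp_all add: lagging_market_def)

lemma prob_space_pref_seq: "prob_space (PiM I (\<lambda>_. pref_law (lagging_market d M)))"
  and prob_space_noise_seq: "prob_space (PiM I (\<lambda>_. noise_law (lagging_market d M)))"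
  by (auto intro!: prob_space_PiM simp: measure_pmf.prob_space_axioms)

lemma finite_cube [simp]: "finite (cube d)"
  by (simp add: cube_def finite_PiE)

lemma card_cube [simp]: "card (cube d) = 2 ^ d"
  by (simp add: cube_def card_PiE numeral_2_eq_2)

lemma cube_nonempty [simp]: "cube d \<noteq> {}"
  by (simp add: cube_def PiE_eq_empty_iff)

lemma cube_bit: "q \<in> cube d \<Longrightarrow> i \<in> {1..d} \<Longrightarrow> q i = 0 \<or> q i = 1"
  by (auto simp: cube_def PiE_iff)

lemma cube_upd: "q \<in> cube d \<Longrightarrow> i \<in> {1..d} \<Longrightarrow> x = 0 \<or> x = 1 \<Longrightarrow> q(i := x) \<in> cube d"
  by (auto simp: cube_def PiE_iff extensional_def)

lemma feedback_in_cube: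
  assumes "q \<in> cube d"
  shows "feedback (lagging_market d M) q \<theta> \<epsilon> \<in> cube d"
  unfolding feedback_def cube_def restrict_PiE_iff using cube_bit[OF assms] by fastforce

lemma prob_bit_noise:
  assumes "x = 0 \<or> x = 1" "y = 0 \<or> y = 1"
  shows "measure bit_noise {e. (if e = 1 then 1 - x else x) = (y::real)} = (if y = x then 4/5 else 1/5)"
proof -
  have "(of_bool :: bool \<Rightarrow> real) -` {e. (if e = 1 then 1 - x else x) = y} = {y \<noteq> x}"
  proof (intro set_eqI)
    fix b show "b \<in> (of_bool :: bool \<Rightarrow> real) -` {e. (if e = 1 then 1 - x else x) = y} \<longleftrightarrow> b \<in> {y \<noteq> x}"
      using assms by (cases b) (elim disjE, simp_all)+
  qed
  then have "measure bit_noise {e. (if e = 1 then 1 - x else x) = y} = pmf (bernoulli_pmf (1/5)) (y \<noteq> x)"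
    by (simp only: bit_noise_def measure_map_pmf measure_pmf_single)
  then show ?thesis
    by (cases "y = x") simp_all
qed

text \<open>Likelihood of a whole review under \<open>d\<close> independent binary symmetric
  channels with crossover probability 1/5.\<close>

definition channel :: "nat \<Rightarrow> vec \<Rightarrow> vec \<Rightarrow> real" where
  "channel d z q = (\<Prod>i=1..d. if z i = q i then 4/5 else 1/5)"

lemma channel_pos: "channel d z q > 0"
  by (auto simp: channel_def intro!: prod_pos)

text \<open>Only the factor of bit \<open>i\<close> changes, between 1/5 and 4/5, so the ratio is 4
  or 1/4. It is written as a square because \<open>evidence\<close> accumulates the roots.\<close>

lemma channel_flip:
  assumes "z \<in> cube d" "i \<in> {1..d}"
  shows "channel d z (q(i := 1)) = (if z i = 1 then 2 else 1/2)\<^sup>2 * channel d z (q(i := 0))"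
proof -
  let ?r = "\<Prod>j\<in>{1..d} - {i}. if z j = q j then 4/5 else 1/5 :: real"
  have "channel d z (q(i := x)) = (if z i = x then 4/5 else 1/5) * ?r" for x
    unfolding channel_def using assms(2) by (subst prod.remove[of _ i]) (auto intro!: prod.cong)
  then show ?thesis
    using cube_bit[OF assms] by (auto simp: power2_eq_square)
qed

lemma prob_feedback:
  assumes "q \<in> cube d" "z \<in> cube d"
  shows "measure (noise_law (lagging_market d M)) {\<epsilon>. feedback (lagging_market d M) q \<theta> \<epsilon> = z}
           = channel d z q"
proof -
  have "{\<epsilon>. feedback (lagging_market d M) q \<theta> \<epsilon> = z}
      = Pi {1..d} (\<lambda>i. {e. (if e = 1 then 1 - q i else q i) = z i})"
    using assms(2)
    by (auto simp: feedback_def cube_def PiE_iff extensional_def fun_eq_iff Pi_def split: if_splits)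
  then show ?thesis
    using cube_bit[OF assms(1)] cube_bit[OF assms(2)]
    by (simp add: measure_Pi_pmf_Pi prob_bit_noise channel_def)
qed

lemma prob_pair_Times:
  assumes "prob_space P" "prob_space N" "A \<in> sets P" "B \<in> sets N"
  shows "measure (P \<Otimes>\<^sub>M N) {x \<in> space (P \<Otimes>\<^sub>M N). fst x \<in> A \<and> snd x \<in> B} = measure P A * measure N B"
proof -
  interpret N: prob_space N by fact
  interpret P: prob_space P by fact
  interpret PN: pair_prob_space P N by unfold_locales
  have "{x \<in> space (P \<Otimes>\<^sub>M N). fst x \<in> A \<and> snd x \<in> B} = A \<times> B"
    using sets.sets_into_space[OF assms(3)] sets.sets_into_space[OF assms(4)]
    by (auto simp: space_pair_measure)
  then show ?thesis
    using N.emeasure_pair_measure_Times[OF assms(3,4)]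
    by (simp add: measure_def enn2real_mult)
qed

definition buy_prob :: "nat \<Rightarrow> real \<Rightarrow> (vec \<Rightarrow> real) \<Rightarrow> real" where
  "buy_prob d M \<pi> = measure (pmf_of_set {0, 1::real}) {\<theta>. buys (lagging_market d M) \<pi> \<theta>}"

lemma buys_high:
  assumes "(\<Sum>q\<in>cube d. \<pi> q) = 1"
  shows "buys (lagging_market d M) \<pi> 1"
  using assms by (simp add: buys_def)

lemma buy_prob_pos:
  assumes "(\<Sum>q\<in>cube d. \<pi> q) = 1"
  shows "buy_prob d M \<pi> > 0"
proof -
  have "buys (lagging_market d M) \<pi> 1"
    using assms by (rule buys_high)
  then show ?thesis
    unfolding buy_prob_def by (intro measure_pmf_posI[of 1]) simp_all
qed

text \<open>Keeps the denominator \<open>1 - buy_prob d M \<pi>\<close> of Bayes' rule positive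
  whenever a refusal is observed.\<close>

lemma buy_prob_less_1:
  assumes "(\<Sum>q\<in>cube d. \<pi> q) = 1" "\<not> buys (lagging_market d M) \<pi> \<theta>"
  shows "buy_prob d M \<pi> < 1"
proof -
  have "\<theta> \<noteq> 1" using buys_high assms by auto
  \<comment> \<open>A preference may be any real, but all values other than 1 share the reward of 0,
    so the refusal passes to the atom 0 of the preference law.\<close>
  then have "\<not> buys (lagging_market d M) \<pi> 0" using assms(2) by (simp add: buys_def)
  then have "measure (pmf_of_set {0, 1::real}) (- {\<theta>. buys (lagging_market d M) \<pi> \<theta>}) > 0"
    by (intro measure_pmf_posI[of 0]) simp_all
  then show ?thesis
    using measure_pmf.prob_compl[of "{\<theta>. buys (lagging_market d M) \<pi> \<theta>}" "pmf_of_set {0, 1::real}"]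
    by (simp add: buy_prob_def Compl_eq_Diff_UNIV)
qed

text \<open>The decision uses the preference alone and the feedback the noise alone, so independence
  factors the likelihood. The first factor does not involve \<open>q\<close> and cancels in Bayes'
  rule.\<close>

lemma G_Some:
  assumes "q \<in> cube d" "z \<in> cube d"
  shows "G (lagging_market d M) (Some z) \<pi> q = buy_prob d M \<pi> * channel d z q"
proof -
  let ?A = "lagging_market d M"
  have "G ?A (Some z) \<pi> q = \<P>(x in type_law ?A. fst x \<in> {\<theta>. buys ?A \<pi> \<theta>}
      \<and> snd x \<in> {\<epsilon>. feedback ?A q undefined \<epsilon> = z})"
    unfolding G_def review_def
    by (intro arg_cong[where f = "measure _"] Collect_cong) (auto simp: feedback_def)
  also have "\<dots> = measure (pref_law ?A) {\<theta>. buys ?A \<pi> \<theta>} *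
      measure (noise_law ?A) {\<epsilon>. feedback ?A q undefined \<epsilon> = z}"
    by (rule prob_pair_Times) (simp_all add: measure_pmf.prob_space_axioms)
  finally show ?thesis
    unfolding prob_feedback[OF assms] by (simp add: buy_prob_def)
qed

text \<open>Constant in \<open>q\<close>: a refusal reveals nothing about the quality and leaves the
  belief unchanged.\<close>

lemma G_None:
  "G (lagging_market d M) None \<pi> q = 1 - buy_prob d M \<pi>"
proof -
  let ?A = "lagging_market d M"
  have "G ?A None \<pi> q = \<P>(x in type_law ?A. fst x \<in> - {\<theta>. buys ?A \<pi> \<theta>} \<and> snd x \<in> UNIV)"
    unfolding G_def review_def by (intro arg_cong[where f = "measure _"] Collect_cong) auto
  also have "\<dots> = measure (pref_law ?A) (- {\<theta>. buys ?A \<pi> \<theta>}) * measure (noise_law ?A) UNIV"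
    by (rule prob_pair_Times) (simp_all add: measure_pmf.prob_space_axioms)
  finally show ?thesis
    using measure_pmf.prob_compl[of "{\<theta>. buys ?A \<pi> \<theta>}" "pmf_of_set {0, 1::real}"]
    by (simp add: buy_prob_def Compl_eq_Diff_UNIV)
qed

section \<open>Admissibility of the market\<close>

lemma lagging_market_valid:
  assumes "d \<ge> 1"
  shows "valid_market (lagging_market d M)"
proof -
  have "feedback_values (lagging_market d M) \<subseteq> cube d"
    by (auto simp: feedback_values_def feedback_in_cube)
  then have "finite (feedback_values (lagging_market d M))"
    by (rule finite_subset) simp
  moreover have "(\<lambda>w. if snd w i = 1 then 1 - x else x)
      \<in> borel_measurable (measure_pmf (pmf_of_set {0, 1::real}) \<Otimes>\<^sub>M
          measure_pmf (Pi_pmf {1..d} 0 (\<lambda>_. bit_noise)))" for i :: nat and x :: real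
  proof -
    have "(\<lambda>e. if e i = 1 then 1 - x else x) \<in> borel_measurable (measure_pmf (Pi_pmf {1..d} 0 (\<lambda>_. bit_noise)))"
      by simp
    from measurable_compose[OF measurable_snd this] show ?thesis .
  qed
  ultimately show ?thesis
    using assms by (simp add: valid_market_def measure_pmf.prob_space_axioms)
qed

lemma lagging_market_lipschitz:
  assumes "M \<ge> 0"
  shows "lipschitz_reward M (lagging_market d M)"
proof -
  have "\<bar>M * ((\<Sum>i=1..d. q i) - a) - M * ((\<Sum>i=1..d. q' i) - a)\<bar> \<le> M * (\<Sum>i=1..d. \<bar>q i - q' i\<bar>)"
    for q q' :: vec and a :: real
  proof -
    have "M * ((\<Sum>i=1..d. q i) - a) - M * ((\<Sum>i=1..d. q' i) - a) = M * (\<Sum>i=1..d. q i - q' i)"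
      by (simp add: algebra_simps sum_subtractf)
    also have "\<bar>\<dots>\<bar> \<le> M * (\<Sum>i=1..d. \<bar>q i - q' i\<bar>)"
      using assms by (auto simp: abs_mult intro!: mult_left_mono)
    finally show ?thesis .
  qed
  then show ?thesis
    using assms by (auto simp: lipschitz_reward_def intro!: mult_nonneg_nonneg sum_nonneg)
qed

lemma lagging_market_purchase_guarantee:
  assumes "M \<ge> 0"
  shows "purchase_guarantee (lagging_market d M)"
proof -
  have "(\<Sum>j=1..d. (q(i := 0)) j) \<le> (\<Sum>j=1..d. (q(i := 1)) j)" for q :: vec and i
    by (intro sum_mono) auto
  moreover have "measure (pmf_of_set {0, 1::real}) {\<theta>. reward (lagging_market d M) q \<theta> > 0} > 0" for q
    by (rule measure_pmf_posI[of 1]) auto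
  ultimately show ?thesis
    using assms by (auto simp: purchase_guarantee_def intro!: mult_left_mono)
qed

lemma lagging_market_identifiable:
  assumes "d \<ge> 1"
  shows "identifiable (lagging_market d M)"
proof -
  let ?A = "lagging_market d M"
  have G_comp: "G_comp ?A i y \<pi> x = buy_prob d M \<pi> * (if y = x then 4/5 else 1/5)"
    if i: "i \<in> {1..d}" and x: "x = 0 \<or> x = 1" and y: "y = 0 \<or> y = 1" for i x y \<pi>
  proof -
    have "G_comp ?A i y \<pi> x = \<P>(x' in type_law ?A. fst x' \<in> {\<theta>. buys ?A \<pi> \<theta>}
        \<and> snd x' \<in> {\<epsilon>. (if \<epsilon> i = 1 then 1 - x else x) = y})"
      unfolding G_comp_def by (intro arg_cong[where f = "measure _"] Collect_cong) auto
    also have "\<dots> = measure (pref_law ?A) {\<theta>. buys ?A \<pi> \<theta>} *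
        measure (noise_law ?A) {\<epsilon>. (if \<epsilon> i = 1 then 1 - x else x) = y}"
      by (rule prob_pair_Times) (simp_all add: measure_pmf.prob_space_axioms)
    also have "measure (noise_law ?A) {\<epsilon>. (if \<epsilon> i = 1 then 1 - x else x) = y}
        = measure (map_pmf (\<lambda>\<epsilon>. \<epsilon> i) (Pi_pmf {1..d} 0 (\<lambda>_. bit_noise))) {e. (if e = 1 then 1 - x else x) = y}"
      by (simp add: vimage_def)
    also have "\<dots> = (if y = x then 4/5 else 1/5)"
      using i by (subst Pi_pmf_component) (simp_all add: prob_bit_noise[OF x y])
    finally show ?thesis by (simp add: buy_prob_def)
  qed
  have fb: "z i = 0 \<or> z i = 1" if "z \<in> feedback_values ?A" "i \<in> {1..d}" for z i
    using that cube_bit[OF feedback_in_cube, of _ d i M] by (auto simp: feedback_values_def)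
  \<comment> \<open>The noiseless review of the best state. Its entries 1 have likelihood
    proportional to 4/5 or 1/5 according to the quality bit, which separates the two bit
    values.\<close>
  have ones: "(\<lambda>i\<in>{1..d}. 1) \<in> feedback_values ?A"
    unfolding feedback_values_def mem_Collect_eq
    by (intro exI[of _ "\<lambda>i\<in>{1..d}. 1"] exI[of _ 0] exI[of _ "\<lambda>_. 0"])
      (auto simp: feedback_def cube_def)
  have pb: "buy_prob d M \<pi> > 0" if "\<pi> \<in> distributions d" for \<pi>
    using that by (intro buy_prob_pos) (simp add: distributions_def)
  then show ?thesis
    unfolding identifiable_def lagging_market_sel
  proof (intro ballI conjI impI)
    fix i \<pi> x z assume "i \<in> {1..d}" "\<pi> \<in> distributions d" "x \<in> {0, 1::real}" "z \<in> feedback_values ?A"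
    then show "0 < G_comp ?A i (z i) \<pi> x"
      using fb[of z i] pb[of \<pi>] by (subst G_comp) auto
  next
    fix i \<pi> x x' assume *: "i \<in> {1..d}" "\<pi> \<in> distributions d" "x \<in> {0, 1::real}" "x' \<in> {0, 1::real}" "x \<noteq> x'"
    then have "G_comp ?A i 1 \<pi> x \<noteq> G_comp ?A i 1 \<pi> x'"
      using pb[of \<pi>] by (auto simp: G_comp)
    then show "\<exists>z\<in>feedback_values ?A. G_comp ?A i (z i) \<pi> x \<noteq> G_comp ?A i (z i) \<pi> x'"
      using ones * by (intro bexI[of _ "\<lambda>i\<in>{1..d}. 1"]) auto
  qed
qed

section \<open>Naive beliefs along a quality path\<close>

text \<open>The purchase probability cancels between \<open>G\<close> and \<open>G_mean\<close>,
  which leaves the normalised channel likelihood after a purchase and the factor 1 after a refusal.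
  Full support of the belief makes the normaliser positive; the second claim is what rules out
  division by zero in Bayes' rule.\<close>

lemma naive_belief_step:
  fixes M :: real
  assumes "t \<ge> 1" "q t \<in> cube d" "k \<in> cube d"
    and pos: "\<And>k. k \<in> cube d \<Longrightarrow> naive_belief (lagging_market d M) q \<theta> \<epsilon> t k > 0"
    and sum1: "(\<Sum>k\<in>cube d. naive_belief (lagging_market d M) q \<theta> \<epsilon> t k) = 1"
  defines "A \<equiv> lagging_market d M"
  defines "\<pi> \<equiv> naive_belief A q \<theta> \<epsilon> t"
  defines "z \<equiv> feedback A (q t) (\<theta> t) (\<epsilon> t)"
  shows "naive_belief A q \<theta> \<epsilon> (Suc t) k =
           (if buys A \<pi> (\<theta> t) then channel d z k / (\<Sum>j\<in>cube d. \<pi> j * channel d z j) else 1) * \<pi> k"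
    and "G_mean A (review A \<pi> (q t) (\<theta> t) (\<epsilon> t)) \<pi> \<noteq> 0"
proof -
  have z: "z \<in> cube d"
    using feedback_in_cube[OF assms(2)] by (simp add: z_def A_def)
  have sum1': "(\<Sum>k\<in>cube d. \<pi> k) = 1" using sum1 by (simp add: \<pi>_def A_def)
  have G_mean_Some: "G_mean A (Some z) \<pi> = buy_prob d M \<pi> * (\<Sum>j\<in>cube d. \<pi> j * channel d z j)"
    by (simp add: G_mean_def A_def G_Some[OF _ z[unfolded A_def]] sum_distrib_left mult_ac)
  have G_mean_None: "G_mean A None \<pi> = 1 - buy_prob d M \<pi>"
    using sum1' by (simp add: G_mean_def A_def G_None flip: sum_distrib_right)
  have bp: "buy_prob d M \<pi> > 0" using sum1' by (rule buy_prob_pos)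
  have bp1: "buy_prob d M \<pi> < 1" if "\<not> buys A \<pi> (\<theta> t)"
    using buy_prob_less_1[OF sum1'] that by (simp add: A_def)
  have spos: "(\<Sum>j\<in>cube d. \<pi> j * channel d z j) > 0"
    using pos by (intro sum_pos) (auto simp: \<pi>_def A_def channel_pos)
  show "G_mean A (review A \<pi> (q t) (\<theta> t) (\<epsilon> t)) \<pi> \<noteq> 0"
    using bp bp1 spos by (auto simp: review_def G_mean_None G_mean_Some simp flip: z_def)
  have "naive_belief A q \<theta> \<epsilon> (Suc t) k =
     (let z = review A \<pi> (q t) (\<theta> t) (\<epsilon> t) in G A z \<pi> k / G_mean A z \<pi> * \<pi> k)"
    using assms(1) by (simp add: Let_def \<pi>_def)
  also have "\<dots> = (if buys A \<pi> (\<theta> t) then channel d z k / (\<Sum>j\<in>cube d. \<pi> j * channel d z j) else 1) * \<pi> k"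
    using bp bp1 G_Some[OF \<open>k \<in> cube d\<close> z, of M \<pi>] G_None[of d M \<pi> k]
    by (auto simp: review_def Let_def G_mean_None G_mean_Some simp flip: A_def z_def)
  finally show "naive_belief A q \<theta> \<epsilon> (Suc t) k =
      (if buys A \<pi> (\<theta> t) then channel d z k / (\<Sum>j\<in>cube d. \<pi> j * channel d z j) else 1) * \<pi> k" .
qed

text \<open>The quality path is frozen: estimates on the learners are made path by path and
  integrated over the paths at the end. Index 0 stays unconstrained because time starts at
  1.\<close>

locale lagging_path =
  fixes d :: nat and M :: real and q :: "nat \<Rightarrow> vec"
  assumes path: "\<And>t. t \<ge> 1 \<Longrightarrow> q t \<in> cube d"
begin

abbreviation "A \<equiv> lagging_market d M"

abbreviation belief :: "(nat \<Rightarrow> real) \<Rightarrow> (nat \<Rightarrow> vec) \<Rightarrow> nat \<Rightarrow> vec \<Rightarrow> real" where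
  "belief \<equiv> naive_belief A q"

text \<open>Proved jointly because each Bayes step needs both: positivity keeps the normaliser
  positive, and total mass 1 ensures that type 1 buys.\<close>

lemma belief_pos_sum:
  "(\<forall>k\<in>cube d. belief \<theta> \<epsilon> t k > 0) \<and> (\<Sum>k\<in>cube d. belief \<theta> \<epsilon> t k) = 1"
proof (induction t)
  case 0
  show ?case by (simp add: uniform_prior_def)
next
  case (Suc t)
  show ?case
  proof (cases "t = 0")
    case True
    then show ?thesis by (simp add: uniform_prior_def)
  next
    case False
    let ?z = "feedback A (q t) (\<theta> t) (\<epsilon> t)" and ?\<pi> = "belief \<theta> \<epsilon> t"
    let ?S = "\<Sum>j\<in>cube d. ?\<pi> j * channel d ?z j"
    have step: "belief \<theta> \<epsilon> (Suc t) k = (if buys A ?\<pi> (\<theta> t) then channel d ?z k / ?S else 1) * ?\<pi> k"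
      if "k \<in> cube d" for k
      using False Suc that path by (intro naive_belief_step) auto
    have S: "?S > 0"
      using Suc by (intro sum_pos) (auto simp: channel_pos)
    have "(\<Sum>k\<in>cube d. channel d ?z k / ?S * ?\<pi> k) = 1"
      using S by (simp add: mult.commute flip: sum_divide_distrib)
    then have "(\<Sum>k\<in>cube d. belief \<theta> \<epsilon> (Suc t) k) = 1"
      using Suc by (cases "buys A ?\<pi> (\<theta> t)") (simp_all add: step del: naive_belief.simps)
    moreover have "\<forall>k\<in>cube d. belief \<theta> \<epsilon> (Suc t) k > 0"
      using Suc S by (auto simp: step channel_pos simp del: naive_belief.simps)
    ultimately show ?thesis by blast
  qed
qed

lemmas belief_pos = belief_pos_sum[THEN conjunct1, rule_format]
lemmas belief_sum = belief_pos_sum[THEN conjunct2]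

lemma belief_step:
  assumes "t \<ge> 1" "k \<in> cube d"
  shows "belief \<theta> \<epsilon> (Suc t) k =
    (if buys A (belief \<theta> \<epsilon> t) (\<theta> t)
     then channel d (feedback A (q t) (\<theta> t) (\<epsilon> t)) k /
       (\<Sum>j\<in>cube d. belief \<theta> \<epsilon> t j * channel d (feedback A (q t) (\<theta> t) (\<epsilon> t)) j)
     else 1) * belief \<theta> \<epsilon> t k"
  by (rule naive_belief_step(1)) (use assms path belief_pos belief_sum in auto)

lemma review_possible:
  assumes "t \<ge> 1"
  shows "G_mean A (naive_review A q \<theta> \<epsilon> t) (belief \<theta> \<epsilon> t) \<noteq> 0"
  unfolding naive_review_def
  by (rule naive_belief_step(2)[where k = "q t"]) (use assms path belief_pos belief_sum in auto)

text \<open>The square root of the likelihood ratio between \<open>q i = 1\<close> and \<open>q i = 0\<close>. Unlike the likelihood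
  ratio itself, which is a martingale when the truth is \<open>0\<close>, it decreases in mean.\<close>

definition evidence :: "nat \<Rightarrow> (nat \<Rightarrow> real) \<Rightarrow> (nat \<Rightarrow> vec) \<Rightarrow> nat \<Rightarrow> real" where
  "evidence i \<theta> \<epsilon> t =
     (\<Prod>s=1..<t. if buys A (belief \<theta> \<epsilon> s) (\<theta> s)
        then if feedback A (q s) (\<theta> s) (\<epsilon> s) i = 1 then 2 else 1/2 else 1)"

lemma evidence_pos: "evidence i \<theta> \<epsilon> t > 0"
  by (auto simp: evidence_def intro!: prod_pos)

text \<open>The normaliser is common to both states and cancels, and the uniform prior starts the
  ratio at 1. The ratio is the same for all \<open>k\<close>, so one number per component governs
  the posterior.\<close>

lemma belief_ratio:
  assumes "i \<in> {1..d}" "k \<in> cube d"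
  shows "belief \<theta> \<epsilon> t (k(i := 1)) = (evidence i \<theta> \<epsilon> t)\<^sup>2 * belief \<theta> \<epsilon> t (k(i := 0))"
proof (induction t)
  case 0
  show ?case by (simp add: evidence_def uniform_prior_def)
next
  case (Suc t)
  show ?case
  proof (cases "t = 0")
    case True
    then show ?thesis by (simp add: evidence_def uniform_prior_def)
  next
    case False
    let ?z = "feedback A (q t) (\<theta> t) (\<epsilon> t)"
    have cube: "k(i := 0) \<in> cube d" "k(i := 1) \<in> cube d"
      using assms by (auto intro: cube_upd)
    have z: "?z \<in> cube d"
      using False path by (intro feedback_in_cube) auto
    have t: "t \<ge> 1" using False by simp
    have ev: "evidence i \<theta> \<epsilon> (Suc t) = evidence i \<theta> \<epsilon> t *
        (if buys A (belief \<theta> \<epsilon> t) (\<theta> t) then if ?z i = 1 then 2 else 1/2 else 1)"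
      unfolding evidence_def prod.atLeastLessThan_Suc[OF t] ..
    show ?thesis
      unfolding belief_step[OF t cube(1)] belief_step[OF t cube(2)] Suc ev channel_flip[OF z assms(1)]
      by (simp add: power_mult_distrib)
  qed
qed

definition mean_component :: "nat \<Rightarrow> (nat \<Rightarrow> real) \<Rightarrow> (nat \<Rightarrow> vec) \<Rightarrow> nat \<Rightarrow> real" where
  "mean_component i \<theta> \<epsilon> t = (\<Sum>k\<in>cube d. belief \<theta> \<epsilon> t k * k i)"

text \<open>With W the evidence, the posterior mean of component \<open>i\<close> is W^2/(1 + W^2).
  The inequality 2W \<le> 1 + W^2 turns this into a bound linear in W, the quantity whose
  expectation is controlled.\<close>

lemma mean_component_bounds:
  assumes i: "i \<in> {1..d}"
  shows "0 \<le> mean_component i \<theta> \<epsilon> t" "mean_component i \<theta> \<epsilon> t \<le> 1"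
    "mean_component i \<theta> \<epsilon> t \<le> evidence i \<theta> \<epsilon> t / 2"
proof -
  let ?b = "belief \<theta> \<epsilon> t" and ?W = "evidence i \<theta> \<epsilon> t"
  define C where "C x = {k \<in> cube d. k i = x}" for x :: real
  have cube_split: "cube d = C 0 \<union> C 1" and disj: "C 0 \<inter> C 1 = {}" and fin: "finite (C x)" for x
    using i by (auto simp: C_def dest: cube_bit)
  define m where "m x = sum ?b (C x)" for x
  have m_nonneg: "m x \<ge> 0" for x
    unfolding m_def using belief_pos by (intro sum_nonneg) (auto simp: C_def less_imp_le)
  have "mean_component i \<theta> \<epsilon> t = (\<Sum>k\<in>C 0. ?b k * k i) + (\<Sum>k\<in>C 1. ?b k * k i)"
    unfolding mean_component_def cube_split by (rule sum.union_disjoint) (use fin disj in auto)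
  also have "(\<Sum>k\<in>C 0. ?b k * k i) = 0" by (intro sum.neutral) (auto simp: C_def)
  also have "(\<Sum>k\<in>C 1. ?b k * k i) = m 1" by (auto simp: C_def m_def intro!: sum.cong)
  finally have mean: "mean_component i \<theta> \<epsilon> t = m 1" by simp
  have tot: "m 0 + m 1 = 1"
    using belief_sum[of \<theta> \<epsilon> t] unfolding m_def cube_split
    by (subst (asm) sum.union_disjoint) (use fin disj in auto)
  have "bij_betw (\<lambda>k. k(i := 1)) (C 0) (C 1)"
    using i by (intro bij_betwI[where g = "\<lambda>k. k(i := 0)"])
      (auto simp: C_def fun_upd_idem dest: cube_upd)
  then have "m 1 = (\<Sum>k\<in>C 0. ?b (k(i := 1)))"
    unfolding m_def by (rule sum.reindex_bij_betw[symmetric])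
  also have "\<dots> = (\<Sum>k\<in>C 0. ?W\<^sup>2 * ?b k)"
    using i by (intro sum.cong) (auto simp: C_def belief_ratio fun_upd_idem)
  finally have m1: "m 1 = ?W\<^sup>2 * m 0"
    by (simp add: m_def sum_distrib_left)
  show "0 \<le> mean_component i \<theta> \<epsilon> t" "mean_component i \<theta> \<epsilon> t \<le> 1"
    using m_nonneg[of 0] m_nonneg[of 1] tot by (auto simp: mean)
  have "2 * ?W \<le> 1 + ?W\<^sup>2"
    using zero_le_power2[of "?W - 1"] by (simp add: power2_eq_square algebra_simps)
  then have "2 * ?W * (?W * m 0) \<le> (1 + ?W\<^sup>2) * (?W * m 0)"
    using evidence_pos[of i \<theta> \<epsilon> t] m_nonneg[of 0] by (intro mult_right_mono) auto
  also have "\<dots> = ?W * (m 0 + m 1)"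
    unfolding m1 by (simp add: algebra_simps)
  also note tot
  finally show "mean_component i \<theta> \<epsilon> t \<le> ?W / 2"
    unfolding mean m1 by (simp add: power2_eq_square mult_ac)
qed

lemma buys_low:
  assumes "M > 0" "\<theta>' \<noteq> 1"
  shows "buys A (belief \<theta> \<epsilon> t) \<theta>' \<longleftrightarrow> (\<Sum>i=1..d. mean_component i \<theta> \<epsilon> t) \<ge> 7/8 * real d"
proof -
  let ?b = "belief \<theta> \<epsilon> t"
  have "(\<Sum>k\<in>cube d. ?b k * reward A k \<theta>')
      = M * ((\<Sum>k\<in>cube d. \<Sum>i=1..d. ?b k * k i) - 7/8 * real d * (\<Sum>k\<in>cube d. ?b k))"
    using assms(2)
    by (simp add: sum_distrib_left sum_distrib_right sum_subtractf algebra_simps)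
  also have "\<dots> = M * ((\<Sum>i=1..d. mean_component i \<theta> \<epsilon> t) - 7/8 * real d)"
    unfolding belief_sum mean_component_def by (subst sum.swap) simp
  finally show ?thesis
    using assms(1) by (simp add: buys_def zero_le_mult_iff del: lagging_market_sel(4))
qed

end

section \<open>Measurability of beliefs and purchases\<close>

lemma measurable_belief:
  fixes N :: "'w measure"
  assumes Q: "\<And>s w. s \<ge> 1 \<Longrightarrow> w \<in> space N \<Longrightarrow> Q s w \<in> cube d"
    and [measurable]: "\<And>s i. s \<ge> 1 \<Longrightarrow> (\<lambda>w. Q s w i) \<in> borel_measurable N"
      "\<And>s. s \<ge> 1 \<Longrightarrow> \<theta> s \<in> borel_measurable N"
      "\<And>s i. s \<ge> 1 \<Longrightarrow> (\<lambda>w. \<epsilon> s w i) \<in> borel_measurable N"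
    and k: "k \<in> cube d"
  shows "(\<lambda>w. naive_belief (lagging_market d M) (\<lambda>s. Q s w) (\<lambda>s. \<theta> s w) (\<lambda>s. \<epsilon> s w) t k)
           \<in> borel_measurable N"
  using k
proof (induction t arbitrary: k)
  case 0
  show ?case by simp
next
  case (Suc t)
  show ?case
  proof (cases "t = 0")
    case True
    then show ?thesis by simp
  next
    case False
    then have t: "t \<ge> 1" by simp
    let ?A = "lagging_market d M"
    let ?b = "\<lambda>w. naive_belief ?A (\<lambda>s. Q s w) (\<lambda>s. \<theta> s w) (\<lambda>s. \<epsilon> s w) t"
    let ?z = "\<lambda>w. feedback ?A (Q t w) (\<theta> t w) (\<epsilon> t w)"
    note [measurable] = Suc.IH
    have [measurable]: "(\<lambda>w. channel d (?z w) j) \<in> borel_measurable N" for j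
      using t unfolding channel_def feedback_def by (auto intro!: borel_measurable_prod)
    have [measurable]: "Measurable.pred N (\<lambda>w. buys ?A (?b w) (\<theta> t w))"
      using t unfolding buys_def lagging_market_sel by measurable
    \<comment> \<open>The closed form of the update replaces \<open>G\<close> and
      \<open>G_mean\<close>: here the random review enters only through the explicit product
      \<open>channel\<close>.\<close>
    have "(\<lambda>w. (if buys ?A (?b w) (\<theta> t w)
        then channel d (?z w) k / (\<Sum>j\<in>cube d. ?b w j * channel d (?z w) j) else 1) * ?b w k)
        \<in> borel_measurable N"
      using Suc.prems by measurable
    also have "?this \<longleftrightarrow> ?thesis"
    proof (intro measurable_cong)
      fix w assume w: "w \<in> space N"
      interpret lagging_path d M "\<lambda>s. Q s w" using Q w by unfold_locales auto
      show "(if buys ?A (?b w) (\<theta> t w)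
        then channel d (?z w) k / (\<Sum>j\<in>cube d. ?b w j * channel d (?z w) j) else 1) * ?b w k =
        naive_belief ?A (\<lambda>s. Q s w) (\<lambda>s. \<theta> s w) (\<lambda>s. \<epsilon> s w) (Suc t) k"
        using belief_step[OF t Suc.prems, of "\<lambda>s. \<theta> s w" "\<lambda>s. \<epsilon> s w"] by (simp only:)
    qed
    finally show ?thesis .
  qed
qed

lemma measurable_buys:
  fixes N :: "'w measure"
  assumes Q: "\<And>s w. s \<ge> 1 \<Longrightarrow> w \<in> space N \<Longrightarrow> Q s w \<in> cube d"
    and [measurable]: "\<And>s i. s \<ge> 1 \<Longrightarrow> (\<lambda>w. Q s w i) \<in> borel_measurable N"
      "\<And>s. s \<ge> 1 \<Longrightarrow> \<theta> s \<in> borel_measurable N"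
      "\<And>s i. s \<ge> 1 \<Longrightarrow> (\<lambda>w. \<epsilon> s w i) \<in> borel_measurable N"
    and "t \<ge> 1"
  shows "Measurable.pred N (\<lambda>w. buys (lagging_market d M)
           (naive_belief (lagging_market d M) (\<lambda>s. Q s w) (\<lambda>s. \<theta> s w) (\<lambda>s. \<epsilon> s w) t) (\<theta> t w))"
  unfolding buys_def lagging_market_sel
  by (measurable, rule measurable_belief) (use assms in auto)

section \<open>Product measures\<close>

text \<open>Independence of coordinate \<open>t\<close> from a function that ignores it. It serves
  to separate the noise of period \<open>t\<close> from everything determined earlier, although the
  index set is infinite.\<close>

lemma nn_integral_PiM_coordinate:
  fixes f v :: "_ \<Rightarrow> ennreal"
  assumes D: "prob_space D" and t: "t \<in> I"
    and f[measurable]: "f \<in> borel_measurable (PiM I (\<lambda>_. D))" and v[measurable]: "v \<in> borel_measurable D"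
    and dep: "\<And>x y. f (x(t := y)) = f x"
  shows "(\<integral>\<^sup>+x. f x * v (x t) \<partial>PiM I (\<lambda>_. D)) = (\<integral>\<^sup>+x. f x \<partial>PiM I (\<lambda>_. D)) * (\<integral>\<^sup>+y. v y \<partial>D)"
proof -
  interpret D: prob_space D by fact
  let ?J = "PiM (I - {t}) (\<lambda>_. D)"
  interpret J: prob_space ?J by (intro prob_space_PiM D)
  interpret DJ: pair_prob_space D ?J by unfold_locales
  have I: "insert t (I - {t}) = I" using t by auto
  have split: "PiM I (\<lambda>_. D) = distr (D \<Otimes>\<^sub>M ?J) (PiM I (\<lambda>_. D)) (\<lambda>(x, X). X(t := x))"
    using distr_pair_PiM_eq_PiM[of "I - {t}" "\<lambda>_. D" t, unfolded I] D by simp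
  have [measurable]: "(\<lambda>(x, X). X(t := x)) \<in> D \<Otimes>\<^sub>M ?J \<rightarrow>\<^sub>M PiM I (\<lambda>_. D)"
    unfolding case_prod_beta using t by (intro measurable_fun_upd[where J = "I - {t}"]) auto
  \<comment> \<open>Points of the smaller product are undefined at \<open>t\<close>; filling in any
    fixed value gives a point of the full product, and \<open>f\<close> does not notice.\<close>
  obtain y0 where y0: "y0 \<in> space D" using D.not_empty by blast
  have [measurable]: "f \<in> borel_measurable ?J"
  proof -
    have "(\<lambda>X. f (X(t := y0))) \<in> borel_measurable ?J"
      using y0 t
      by (intro measurable_compose[OF measurable_fun_upd[where J = "I - {t}"] f]) (auto simp: I)
    then show ?thesis by (simp add: dep)
  qed
  have *: "(\<integral>\<^sup>+x. f x * w (x t) \<partial>PiM I (\<lambda>_. D)) = (\<integral>\<^sup>+x. f x \<partial>?J) * (\<integral>\<^sup>+y. w y \<partial>D)"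
    if [measurable]: "w \<in> borel_measurable D" for w :: "_ \<Rightarrow> ennreal"
  proof -
    have "(\<lambda>x. f x * w (x t)) \<in> borel_measurable (PiM I (\<lambda>_. D))"
      using t by measurable
    then have "(\<integral>\<^sup>+x. f x * w (x t) \<partial>PiM I (\<lambda>_. D)) = (\<integral>\<^sup>+p. f (snd p) * w (fst p) \<partial>(D \<Otimes>\<^sub>M ?J))"
      by (subst split, subst nn_integral_distr) (auto simp: case_prod_beta dep)
    also have "\<dots> = (\<integral>\<^sup>+y. \<integral>\<^sup>+X. f X * w y \<partial>?J \<partial>D)"
      by (subst J.nn_integral_fst[symmetric]) auto
    also have "\<dots> = (\<integral>\<^sup>+x. f x \<partial>?J) * (\<integral>\<^sup>+y. w y \<partial>D)"
      by (simp add: nn_integral_multc nn_integral_cmult)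
    finally show ?thesis .
  qed
  \<comment> \<open>The instance with constant weight 1 identifies the integral of \<open>f\<close>
    over the smaller product with that over the full one.\<close>
  from *[OF v] *[of "\<lambda>_. 1"] show ?thesis
    by (simp add: D.emeasure_space_1)
qed

lemma nn_integral_PiM_prod:
  fixes v :: "'i \<Rightarrow> 'a \<Rightarrow> ennreal"
  assumes D: "prob_space D" and "finite J" "J \<subseteq> I"
    and v[measurable]: "\<And>s. s \<in> J \<Longrightarrow> v s \<in> borel_measurable D"
  shows "(\<integral>\<^sup>+x. (\<Prod>s\<in>J. v s (x s)) \<partial>PiM I (\<lambda>_. D)) = (\<Prod>s\<in>J. \<integral>\<^sup>+y. v s y \<partial>D)"
  using assms(2,3,4)
proof (induction J)
  case empty
  interpret prob_space "PiM I (\<lambda>_. D)" by (intro prob_space_PiM D)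
  show ?case by (simp add: emeasure_space_1)
next
  case (insert t J)
  have "(\<integral>\<^sup>+x. (\<Prod>s\<in>insert t J. v s (x s)) \<partial>PiM I (\<lambda>_. D)) =
      (\<integral>\<^sup>+x. (\<Prod>s\<in>J. v s (x s)) * v t (x t) \<partial>PiM I (\<lambda>_. D))"
    using insert by (simp add: mult.commute)
  also have "\<dots> = (\<integral>\<^sup>+x. (\<Prod>s\<in>J. v s (x s)) \<partial>PiM I (\<lambda>_. D)) * (\<integral>\<^sup>+y. v t y \<partial>D)"
  proof (rule nn_integral_PiM_coordinate[OF D])
    show "(\<lambda>x. \<Prod>s\<in>J. v s (x s)) \<in> borel_measurable (PiM I (\<lambda>_. D))"
    proof (intro borel_measurable_prod_ennreal)
      fix s assume "s \<in> J"
      with insert.prems show "(\<lambda>x. v s (x s)) \<in> borel_measurable (PiM I (\<lambda>_. D))"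
        by (intro measurable_compose[OF measurable_component_singleton[of s]]) auto
    qed
    show "(\<Prod>s\<in>J. v s ((x(t := y)) s)) = (\<Prod>s\<in>J. v s (x s))" for x y
      using insert.hyps by (intro prod.cong) auto
  qed (use insert in auto)
  finally show ?case
    using insert by (simp add: mult.commute)
qed

lemma nn_integral_fair_bit:
  assumes "r 0 \<ge> 0" "r 1 \<ge> 0"
  shows "(\<integral>\<^sup>+y. ennreal (r y) \<partial>pmf_of_set {0, 1::real}) = ennreal ((r 0 + r 1) / 2)"
proof -
  have "(\<integral>\<^sup>+y. ennreal (r y) \<partial>pmf_of_set {0, 1::real}) = (ennreal (r 0) + ennreal (r 1)) / 2"
    by (subst nn_integral_pmf_of_set) auto
  also have "\<dots> = ennreal ((r 0 + r 1) / 2)"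
    using assms by (simp add: ennreal_divide_numeral flip: ennreal_plus)
  finally show ?thesis .
qed

lemma nn_integral_noise_bit:
  assumes "i \<in> {1..d}"
  shows "(\<integral>\<^sup>+e. v (e i) \<partial>noise_law (lagging_market d M)) = ennreal (4/5) * v 0 + ennreal (1/5) * v 1"
proof -
  have "(\<integral>\<^sup>+e. v (e i) \<partial>noise_law (lagging_market d M)) =
      (\<integral>\<^sup>+y. v y \<partial>map_pmf (\<lambda>e. e i) (Pi_pmf {1..d} 0 (\<lambda>_. bit_noise)))"
    by simp
  also have "map_pmf (\<lambda>e. e i) (Pi_pmf {1..d} 0 (\<lambda>_. bit_noise)) = bit_noise"
    using assms by (subst Pi_pmf_component) auto
  finally show ?thesis
    by (simp add: bit_noise_def ac_simps)
qed

lemma distr_pair_snd: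
  assumes "prob_space N" "sigma_finite_measure M"
  shows "distr (N \<Otimes>\<^sub>M M) M snd = M"
proof (intro measure_eqI)
  interpret N: prob_space N by fact
  interpret M: sigma_finite_measure M by fact
  fix A assume A: "A \<in> sets (distr (N \<Otimes>\<^sub>M M) M snd)"
  then have "emeasure (distr (N \<Otimes>\<^sub>M M) M snd) A = emeasure (N \<Otimes>\<^sub>M M) (space N \<times> A)"
    by (auto simp: emeasure_distr space_pair_measure dest: sets.sets_into_space intro!: arg_cong2[where f = emeasure])
  with A show "emeasure (distr (N \<Otimes>\<^sub>M M) M snd) A = emeasure M A"
    by (simp add: M.emeasure_pair_measure_Times N.emeasure_space_1)
qed simp

section \<open>Independent sequences on product spaces\<close>

lemma sequence_events_eq:
  assumes "p \<in> \<Omega> \<rightarrow>\<^sub>M PiM {1..} (\<lambda>_. D)"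
  shows "sequence_events D \<Omega> (\<lambda>t \<omega>. p \<omega> t) = {p -` B \<inter> space \<Omega> | B. B \<in> sets (PiM {1..} (\<lambda>_. D))}"
proof -
  have "sequence_events D \<Omega> (\<lambda>t \<omega>. p \<omega> t) = sets (vimage_algebra (space \<Omega>) p (PiM {1..} (\<lambda>_. D)))"
    unfolding sequence_events_def
  proof (intro arg_cong[where f = sets] vimage_algebra_cong refl)
    fix \<omega> assume "\<omega> \<in> space \<Omega>"
    then have "p \<omega> \<in> space (PiM {1..} (\<lambda>_. D))" using assms by (rule measurable_space[rotated])
    then show "(\<lambda>t\<in>{1..}. p \<omega> t) = p \<omega>" by (simp add: space_PiM)
  qed
  also have "\<dots> = {p -` B \<inter> space \<Omega> | B. B \<in> sets (PiM {1..} (\<lambda>_. D))}"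
    using measurable_space[OF assms] by (intro sets_vimage_algebra2) auto
  finally show ?thesis .
qed

lemma iid_sequence_PiM:
  assumes D: "prob_space D" and \<Omega>: "prob_space \<Omega>"
    and p: "p \<in> \<Omega> \<rightarrow>\<^sub>M PiM {1..} (\<lambda>_. D)" and law: "distr \<Omega> (PiM {1..} (\<lambda>_. D)) p = PiM {1..} (\<lambda>_. D)"
  shows "iid_sequence D \<Omega> (\<lambda>t \<omega>. p \<omega> t)"
proof -
  interpret \<Omega>: prob_space \<Omega> by fact
  have marginal: "distr \<Omega> D (\<lambda>\<omega>. p \<omega> t) = D" if "t \<ge> 1" for t
  proof -
    have "distr \<Omega> D (\<lambda>\<omega>. p \<omega> t) = distr (distr \<Omega> (PiM {1..} (\<lambda>_. D)) p) D (\<lambda>x. x t)"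
      using that p by (subst distr_distr) (auto simp: comp_def)
    also have "\<dots> = D"
      unfolding law using that D by (intro distr_PiM_component) auto
    finally show ?thesis .
  qed
  have "\<Omega>.indep_vars (\<lambda>_. D) (\<lambda>t \<omega>. p \<omega> t) {1..}"
  proof (subst \<Omega>.indep_vars_iff_distr_eq_PiM')
    show "\<Omega>.random_variable D (\<lambda>\<omega>. p \<omega> t)" if "t \<in> {1..}" for t
      using measurable_compose[OF p measurable_component_singleton[OF that]] by simp
    have "distr \<Omega> (PiM {1..} (\<lambda>_. D)) (\<lambda>\<omega>. \<lambda>t\<in>{1..}. p \<omega> t) = distr \<Omega> (PiM {1..} (\<lambda>_. D)) p"
    proof (intro distr_cong refl)
      fix \<omega> assume "\<omega> \<in> space \<Omega>"
      then have "p \<omega> \<in> {1..} \<rightarrow>\<^sub>E space D" using measurable_space[OF p] by (simp add: space_PiM)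
      then show "(\<lambda>t\<in>{1..}. p \<omega> t) = p \<omega>" by simp
    qed
    also have "\<dots> = PiM {1..} (\<lambda>t. distr \<Omega> D (\<lambda>\<omega>. p \<omega> t))"
      unfolding law by (intro PiM_cong) (simp_all add: marginal)
    finally show "distr \<Omega> (PiM {1..} (\<lambda>_. D)) (\<lambda>\<omega>. \<lambda>t\<in>{1..}. p \<omega> t) = PiM {1..} (\<lambda>t. distr \<Omega> D (\<lambda>\<omega>. p \<omega> t))" .
  qed auto
  then show ?thesis by (simp add: iid_sequence_def marginal)
qed

text \<open>Each generated sigma-algebra consists of the cylinders over one factor, and three
  cylinders over different factors meet in a box, whose measure is a product.\<close>

lemma indep_sequence_events:
  assumes M: "prob_space M1" "prob_space M2" "prob_space M3"
    and s1: "sets M1 = sets (PiM {1..} (\<lambda>_. D1))"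
    and s2: "sets M2 = sets (PiM {1..} (\<lambda>_. D2))"
    and s3: "sets M3 = sets (PiM {1..} (\<lambda>_. D3))"
  defines "\<Omega> \<equiv> M1 \<Otimes>\<^sub>M (M2 \<Otimes>\<^sub>M M3)"
  shows "prob_space.indep_sets \<Omega>
       (\<lambda>k. [sequence_events D1 \<Omega> (\<lambda>t \<omega>. fst \<omega> t), sequence_events D2 \<Omega> (\<lambda>t \<omega>. fst (snd \<omega>) t),
             sequence_events D3 \<Omega> (\<lambda>t \<omega>. snd (snd \<omega>) t)] ! k) {..<3}"
    (is "prob_space.indep_sets \<Omega> ?F _")
proof -
  interpret M1: prob_space M1 by fact
  interpret M2: prob_space M2 by fact
  interpret M3: prob_space M3 by fact
  interpret M23: pair_prob_space M2 M3 ..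
  interpret \<Omega>: pair_prob_space M1 "M2 \<Otimes>\<^sub>M M3" ..
  have space: "space \<Omega> = space M1 \<times> space M2 \<times> space M3"
    by (simp add: \<Omega>_def space_pair_measure)
  have e1: "sequence_events D1 \<Omega> (\<lambda>t \<omega>. fst \<omega> t) = {B \<times> space M2 \<times> space M3 | B. B \<in> sets M1}" (is "_ = ?E1")
  proof -
    have "fst \<in> \<Omega> \<rightarrow>\<^sub>M PiM {1..} (\<lambda>_. D1)"
      unfolding \<Omega>_def by (subst measurable_cong_sets[OF refl s1[symmetric]]) simp
    from sequence_events_eq[OF this]
    have "sequence_events D1 \<Omega> (\<lambda>t \<omega>. fst \<omega> t) = {fst -` B \<inter> space \<Omega> | B. B \<in> sets M1}" by (simp add: s1)
    also have "\<dots> = ?E1"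
      unfolding space by (intro Collect_cong ex_cong1) (auto dest: sets.sets_into_space)
    finally show ?thesis .
  qed
  have e2: "sequence_events D2 \<Omega> (\<lambda>t \<omega>. fst (snd \<omega>) t) = {space M1 \<times> B \<times> space M3 | B. B \<in> sets M2}" (is "_ = ?E2")
  proof -
    have "(\<lambda>\<omega>. fst (snd \<omega>)) \<in> \<Omega> \<rightarrow>\<^sub>M PiM {1..} (\<lambda>_. D2)"
      unfolding \<Omega>_def by (subst measurable_cong_sets[OF refl s2[symmetric]]) simp
    from sequence_events_eq[OF this]
    have "sequence_events D2 \<Omega> (\<lambda>t \<omega>. fst (snd \<omega>) t) = {(\<lambda>\<omega>. fst (snd \<omega>)) -` B \<inter> space \<Omega> | B. B \<in> sets M2}"
      by (simp add: s2)
    also have "\<dots> = ?E2"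
      unfolding space by (intro Collect_cong ex_cong1) (auto dest: sets.sets_into_space)
    finally show ?thesis .
  qed
  have e3: "sequence_events D3 \<Omega> (\<lambda>t \<omega>. snd (snd \<omega>) t) = {space M1 \<times> space M2 \<times> B | B. B \<in> sets M3}" (is "_ = ?E3")
  proof -
    have "(\<lambda>\<omega>. snd (snd \<omega>)) \<in> \<Omega> \<rightarrow>\<^sub>M PiM {1..} (\<lambda>_. D3)"
      unfolding \<Omega>_def by (subst measurable_cong_sets[OF refl s3[symmetric]]) simp
    from sequence_events_eq[OF this]
    have "sequence_events D3 \<Omega> (\<lambda>t \<omega>. snd (snd \<omega>) t) = {(\<lambda>\<omega>. snd (snd \<omega>)) -` B \<inter> space \<Omega> | B. B \<in> sets M3}"
      by (simp add: s3)
    also have "\<dots> = ?E3"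
      unfolding space by (intro Collect_cong ex_cong1) (auto dest: sets.sets_into_space)
    finally show ?thesis .
  qed
  have box: "measure \<Omega> (B1 \<times> B2 \<times> B3) = measure M1 B1 * (measure M2 B2 * measure M3 B3)"
    if "B1 \<in> sets M1" "B2 \<in> sets M2" "B3 \<in> sets M3" for B1 B2 B3
    using that unfolding \<Omega>_def
    by (simp add: measure_def M23.emeasure_pair_measure_Times M3.emeasure_pair_measure_Times enn2real_mult)
  have three: "{..<3} = {0, 1, 2 :: nat}" by auto
  show ?thesis
    unfolding \<Omega>_def
  \<comment> \<open>Each family contains the whole space, so the product rule need only be checked
    for intersections of all three; smaller subfamilies are covered by inserting the whole
    space.\<close>
  proof (subst \<Omega>.indep_sets_finite, unfold \<Omega>_def[symmetric])
    show "?F i \<subseteq> sets \<Omega>" "space \<Omega> \<in> ?F i" if "i \<in> {..<3}" for i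
      using that unfolding three by (auto simp: e1 e2 e3 space) (auto simp: \<Omega>_def intro!: pair_measureI)
    show "\<forall>X\<in>Pi {..<3} ?F. measure \<Omega> (\<Inter>j\<in>{..<3}. X j) = (\<Prod>j\<in>{..<3}. measure \<Omega> (X j))"
    proof
      fix X assume X: "X \<in> Pi {..<3} ?F"
      from X have "X 0 \<in> ?E1" "X 1 \<in> ?E2" "X 2 \<in> ?E3"
        unfolding three using e1 e2 e3 by auto
      then obtain B1 B2 B3 where B: "B1 \<in> sets M1" "B2 \<in> sets M2" "B3 \<in> sets M3"
        and X_eq: "X 0 = B1 \<times> space M2 \<times> space M3" "X 1 = space M1 \<times> B2 \<times> space M3" "X 2 = space M1 \<times> space M2 \<times> B3"
        by auto
      have "(\<Inter>j\<in>{..<3}. X j) = B1 \<times> B2 \<times> B3"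
        unfolding three using B by (auto simp: X_eq dest: sets.sets_into_space)
      then show "measure \<Omega> (\<Inter>j\<in>{..<3}. X j) = (\<Prod>j\<in>{..<3}. measure \<Omega> (X j))"
        using B by (simp add: three X_eq box M1.prob_space M2.prob_space M3.prob_space)
    qed
  qed (simp_all add: three)
qed

section \<open>Evidence against a bad component\<close>

text \<open>Adaptedness: the belief at time \<open>t\<close> uses the strict past only, so it does
  not see the noise of period \<open>t\<close>.\<close>

lemma naive_belief_cong:
  assumes "\<And>s. 1 \<le> s \<Longrightarrow> s < t \<Longrightarrow> q s = q' s \<and> \<theta> s = \<theta>' s \<and> \<epsilon> s = \<epsilon>' s"
  shows "naive_belief A q \<theta> \<epsilon> t = naive_belief A q' \<theta>' \<epsilon>' t"
  using assms
proof (induction t)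
  case (Suc t)
  then have "naive_belief A q \<theta> \<epsilon> t = naive_belief A q' \<theta>' \<epsilon>' t" by simp
  then show ?case using Suc.prems[of t] by simp
qed simp

context lagging_path
begin

abbreviation "prefs \<equiv> PiM {1::nat..} (\<lambda>_. pref_law A)"
abbreviation "noises \<equiv> PiM {1::nat..} (\<lambda>_. noise_law A)"

lemma measurable_path_belief:
  shows "k \<in> cube d \<Longrightarrow> (\<lambda>w. belief (\<lambda>s. fst w s) (\<lambda>s. snd w s) t k) \<in> borel_measurable (prefs \<Otimes>\<^sub>M noises)"
    and "t \<ge> 1 \<Longrightarrow> Measurable.pred (prefs \<Otimes>\<^sub>M noises)
      (\<lambda>w. buys A (belief (\<lambda>s. fst w s) (\<lambda>s. snd w s) t) (fst w t))"
proof -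
  have comp: "(\<lambda>w. fst w s) \<in> borel_measurable (prefs \<Otimes>\<^sub>M noises)"
    "(\<lambda>w. snd w s i) \<in> borel_measurable (prefs \<Otimes>\<^sub>M noises)" if "s \<ge> 1" for s i
  proof -
    have "(\<lambda>\<theta>. \<theta> s) \<in> prefs \<rightarrow>\<^sub>M pref_law A" "(\<lambda>\<epsilon>. \<epsilon> s) \<in> noises \<rightarrow>\<^sub>M noise_law A"
      using that by auto
    moreover have "(\<lambda>x. x) \<in> borel_measurable (pref_law A)" "(\<lambda>e. e i) \<in> borel_measurable (noise_law A)"
      by simp_all
    ultimately have "(\<lambda>\<theta>. \<theta> s) \<in> borel_measurable prefs" "(\<lambda>\<epsilon>. \<epsilon> s i) \<in> borel_measurable noises"
      by (auto intro: measurable_compose[of "\<lambda>\<theta>. \<theta> s"] measurable_compose[of "\<lambda>\<epsilon>. \<epsilon> s" _ _ "\<lambda>e. e i"]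
          simp del: lagging_market_sel)
    then show "(\<lambda>w. fst w s) \<in> borel_measurable (prefs \<Otimes>\<^sub>M noises)"
      "(\<lambda>w. snd w s i) \<in> borel_measurable (prefs \<Otimes>\<^sub>M noises)"
      by (auto intro: measurable_compose[OF measurable_fst] measurable_compose[OF measurable_snd])
  qed
  show "(\<lambda>w. belief (\<lambda>s. fst w s) (\<lambda>s. snd w s) t k) \<in> borel_measurable (prefs \<Otimes>\<^sub>M noises)"
    if "k \<in> cube d"
    using path comp that by (intro measurable_belief) auto
  show "Measurable.pred (prefs \<Otimes>\<^sub>M noises) (\<lambda>w. buys A (belief (\<lambda>s. fst w s) (\<lambda>s. snd w s) t) (fst w t))"
    if "t \<ge> 1"
    using path comp that by (intro measurable_buys) auto
qed

lemma buys_at_1: "buys A (belief \<theta> \<epsilon> t) 1"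
  using belief_sum by (rule buys_high)

lemma measurable_pair_noises:
  assumes "f \<in> borel_measurable (prefs \<Otimes>\<^sub>M noises)" "\<theta> \<in> space prefs"
  shows "(\<lambda>\<epsilon>. f (\<theta>, \<epsilon>)) \<in> borel_measurable noises"
  using measurable_compose[OF measurable_Pair1'[OF assms(2)] assms(1)] .

lemma measurable_evidence:
  assumes "i \<in> {1..d}"
  shows "(\<lambda>w. evidence i (\<lambda>s. fst w s) (\<lambda>s. snd w s) t) \<in> borel_measurable (prefs \<Otimes>\<^sub>M noises)"
  unfolding evidence_def
proof (intro borel_measurable_prod)
  fix s assume s: "s \<in> {1..<t}"
  have buy: "Measurable.pred (prefs \<Otimes>\<^sub>M noises)
      (\<lambda>w. buys A (belief (\<lambda>s. fst w s) (\<lambda>s. snd w s) s) (fst w s))"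
    using measurable_path_belief(2)[of s] s by simp
  have "(\<lambda>w. snd w s) \<in> prefs \<Otimes>\<^sub>M noises \<rightarrow>\<^sub>M noise_law A"
    using s by (intro measurable_compose[OF measurable_snd measurable_component_singleton]) auto
  then have "Measurable.pred (prefs \<Otimes>\<^sub>M noises) (\<lambda>w. feedback A (q s) 0 (snd w s) i = 1)"
    by (rule measurable_compose) simp
  then have fb: "Measurable.pred (prefs \<Otimes>\<^sub>M noises) (\<lambda>w. feedback A (q s) (fst w s) (snd w s) i = 1)"
    unfolding feedback_def lagging_market_sel .
  show "(\<lambda>w. if buys A (belief (\<lambda>s. fst w s) (\<lambda>s. snd w s) s) (fst w s)
      then if feedback A (q s) (fst w s) (snd w s) i = 1 then 2 else 1/2 else (1::real))
      \<in> borel_measurable (prefs \<Otimes>\<^sub>M noises)"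
    by (intro measurable_If measurable_const buy[unfolded pred_def] fb[unfolded pred_def]) auto
qed

text \<open>The mean factors \<open>4/5 * 1/2 + 1/5 * 2 = 4/5\<close> and \<open>4/5 * 2 + 1/5 * 1/2 = 17/10\<close> of a purchase. A
  low type may not buy and then contributes the factor \<open>1\<close>, while a high type always buys.\<close>

definition growth :: "nat \<Rightarrow> nat \<Rightarrow> real \<Rightarrow> ennreal" where
  "growth i s y = ennreal (if q s i = 0 then if y = 1 then 4/5 else 1 else 17/10)"

text \<open>Given the preferences, the evidence before \<open>t\<close> and the decision at
  \<open>t\<close> depend on earlier noises only, so the signal of period \<open>t\<close> is
  independent of both and contributes its mean factor. Induction over the periods then multiplies
  these factors.\<close>

lemma nn_integral_evidence:
  assumes i: "i \<in> {1..d}" and \<theta>: "\<theta> \<in> space prefs"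
  shows "(\<integral>\<^sup>+\<epsilon>. ennreal (evidence i \<theta> \<epsilon> t) \<partial>noises) \<le> (\<Prod>s=1..<t. growth i s (\<theta> s))"
proof (induction t)
  case 0
  interpret prob_space noises by (rule prob_space_noise_seq)
  show ?case by (simp add: evidence_def emeasure_space_1 del: lagging_market_sel)
next
  case (Suc t)
  interpret prob_space noises by (rule prob_space_noise_seq)
  show ?case
  proof (cases "t = 0")
    case True
    then show ?thesis by (simp add: evidence_def emeasure_space_1 del: lagging_market_sel)
  next
    case False
    then have t: "t \<ge> 1" by simp
    let ?c = "growth i t (\<theta> t)"
    define B where "B \<epsilon> \<longleftrightarrow> buys A (belief \<theta> \<epsilon> t) (\<theta> t)" for \<epsilon>
    define r where "r e = (if (if e = 1 then 1 - q t i else q t i) = 1 then 2 else 1/2 :: real)" for e :: real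
    define v where "v e = ennreal (r e)" for e
    have r: "r e \<ge> 0" for e by (simp add: r_def)
    define W where "W \<epsilon> = ennreal (evidence i \<theta> \<epsilon> t)" for \<epsilon>
    \<comment> \<open>The decision of a low type is random through past noises, so the evidence is
      split by it: the new signal multiplies \<open>WB\<close> only.\<close>
    define WB WN where "WB \<epsilon> = (if B \<epsilon> then W \<epsilon> else 0)" and "WN \<epsilon> = (if B \<epsilon> then 0 else W \<epsilon>)" for \<epsilon>
    have "(\<lambda>\<epsilon>. evidence i \<theta> \<epsilon> t) \<in> borel_measurable noises"
      using measurable_pair_noises[OF measurable_evidence[OF i] \<theta>] by (simp only: fst_conv snd_conv)
    then have [measurable]: "W \<in> borel_measurable noises"
      unfolding W_def by (rule measurable_compose[OF _ measurable_ennreal])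
    have [measurable]: "Measurable.pred noises B"
      using measurable_compose[OF measurable_Pair1'[OF \<theta>] measurable_path_belief(2)[OF t]]
      unfolding B_def by (simp only: fst_conv snd_conv)
    have [measurable]: "WB \<in> borel_measurable noises" "WN \<in> borel_measurable noises"
      unfolding WB_def WN_def by measurable
    have q: "q t i = 0 \<or> q t i = 1" using path t i by (intro cube_bit) auto
    have v: "(\<integral>\<^sup>+e. v (e i) \<partial>noise_law A) = ennreal (if q t i = 0 then 4/5 else 17/10)"
    proof -
      have "4/5 * r 0 + 1/5 * r 1 = (if q t i = 0 then 4/5 else 17/10)"
        using q by (elim disjE) (simp_all add: r_def)
      moreover have "ennreal (4/5) * v 0 + ennreal (1/5) * v 1 = ennreal (4/5 * r 0 + 1/5 * r 1)"
        unfolding v_def using r[of 0] r[of 1]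
        by (subst ennreal_plus) (auto simp only: ennreal_mult' intro!: mult_nonneg_nonneg)
      ultimately show ?thesis
        unfolding nn_integral_noise_bit[OF i] by (simp only:)
    qed
    have [measurable]: "(\<lambda>\<epsilon>. v (\<epsilon> t i)) \<in> borel_measurable noises"
      using t by (intro measurable_compose[OF measurable_component_singleton[of t], where g = "\<lambda>e. v (e i)"]) auto
    have ev: "ennreal (evidence i \<theta> \<epsilon> (Suc t)) = WB \<epsilon> * v (\<epsilon> t i) + WN \<epsilon>" for \<epsilon>
    proof -
      have fb: "feedback A (q t) (\<theta> t) (\<epsilon> t) i = (if \<epsilon> t i = 1 then 1 - q t i else q t i)"
        using i by (simp add: feedback_def)
      have "evidence i \<theta> \<epsilon> (Suc t) = evidence i \<theta> \<epsilon> t *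
          (if B \<epsilon> then r (\<epsilon> t i) else 1)"
        unfolding evidence_def prod.atLeastLessThan_Suc[OF t] B_def r_def fb ..
      moreover have "ennreal (evidence i \<theta> \<epsilon> t * r (\<epsilon> t i)) = W \<epsilon> * v (\<epsilon> t i)"
        unfolding W_def v_def by (rule ennreal_mult') (rule less_imp_le[OF evidence_pos])
      ultimately show ?thesis
        by (cases "B \<epsilon>") (simp_all only: WB_def WN_def W_def if_True if_False mult_1_right mult_zero_left add_0 add_0_right)
    qed
    have loc: "WB (\<epsilon>(t := y)) = WB \<epsilon>" for \<epsilon> y
    proof -
      have b: "belief \<theta> (\<epsilon>(t := y)) s = belief \<theta> \<epsilon> s" if "s \<le> t" for s
        using that by (intro naive_belief_cong) auto
      have "evidence i \<theta> (\<epsilon>(t := y)) t = evidence i \<theta> \<epsilon> t"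
        unfolding evidence_def by (intro prod.cong) (auto simp: b)
      then show ?thesis by (simp add: WB_def W_def B_def b)
    qed
    \<comment> \<open>After a refusal the type is not 1, and then \<open>growth\<close> is at least
      1 in either quality state; after a purchase \<open>growth\<close> dominates the mean factor of
      the signal.\<close>
    have le: "WB \<epsilon> * ennreal (if q t i = 0 then 4/5 else 17/10) + WN \<epsilon> \<le> W \<epsilon> * ?c" for \<epsilon>
    proof (cases "B \<epsilon>")
      case True
      have "ennreal (if q t i = 0 then 4/5 else 17/10) \<le> ?c"
        unfolding growth_def by (intro ennreal_leI) simp
      with True show ?thesis by (simp add: WB_def WN_def mult_left_mono)
    next
      case False
      then have "\<theta> t \<noteq> 1" using buys_at_1 by (auto simp: B_def)
      then have "1 \<le> ?c"
        unfolding growth_def ennreal_1[symmetric] by (intro ennreal_leI) simp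
      from mult_left_mono[OF this, of "W \<epsilon>"] False show ?thesis by (simp add: WB_def WN_def)
    qed
    have "(\<integral>\<^sup>+\<epsilon>. ennreal (evidence i \<theta> \<epsilon> (Suc t)) \<partial>noises) =
        (\<integral>\<^sup>+\<epsilon>. WB \<epsilon> * v (\<epsilon> t i) \<partial>noises) + (\<integral>\<^sup>+\<epsilon>. WN \<epsilon> \<partial>noises)"
      unfolding ev by (rule nn_integral_add) measurable
    also have "(\<integral>\<^sup>+\<epsilon>. WB \<epsilon> * v (\<epsilon> t i) \<partial>noises) =
        (\<integral>\<^sup>+\<epsilon>. WB \<epsilon> \<partial>noises) * (\<integral>\<^sup>+e. v (e i) \<partial>noise_law A)"
    proof (rule nn_integral_PiM_coordinate)
      show "prob_space (noise_law A)" by (simp add: measure_pmf.prob_space_axioms)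
      show "t \<in> {1..}" using t by simp
      show "WB \<in> borel_measurable noises" by measurable
      show "(\<lambda>e. v (e i)) \<in> borel_measurable (noise_law A)" by simp
    qed (rule loc)
    also have "\<dots> = (\<integral>\<^sup>+\<epsilon>. WB \<epsilon> * ennreal (if q t i = 0 then 4/5 else 17/10) \<partial>noises)"
      unfolding v by (rule nn_integral_multc[symmetric]) measurable
    also have "\<dots> + (\<integral>\<^sup>+\<epsilon>. WN \<epsilon> \<partial>noises) =
        (\<integral>\<^sup>+\<epsilon>. WB \<epsilon> * ennreal (if q t i = 0 then 4/5 else 17/10) + WN \<epsilon> \<partial>noises)"
      by (rule nn_integral_add[symmetric]) measurable
    also have "\<dots> \<le> (\<integral>\<^sup>+\<epsilon>. W \<epsilon> * ?c \<partial>noises)"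
      by (intro nn_integral_mono le)
    also have "\<dots> = (\<integral>\<^sup>+\<epsilon>. W \<epsilon> \<partial>noises) * ?c"
      by (rule nn_integral_multc) measurable
    also have "\<dots> \<le> (\<Prod>s=1..<t. growth i s (\<theta> s)) * ?c"
      using Suc by (intro mult_right_mono) (auto simp: W_def)
    finally show ?thesis
      unfolding prod.atLeastLessThan_Suc[OF t] .
  qed
qed

definition zeros :: "nat \<Rightarrow> nat \<Rightarrow> nat set" where
  "zeros i t = {s \<in> {1..<t}. q s i = 0}"

definition nonzeros :: "nat \<Rightarrow> nat \<Rightarrow> nat set" where
  "nonzeros i t = {s \<in> {1..<t}. q s i \<noteq> 0}"

text \<open>Averaging over the two types gives a factor \<open>9/10\<close> per period with quality \<open>0\<close>, and
  \<open>(9/10)^6 * 17/10 \<le> 1\<close>: six such periods outweigh one period with quality \<open>1\<close>.\<close>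

lemma nn_integral_low_type_evidence:
  assumes i: "i \<in> {1..d}" and t: "t \<ge> 1" and lag: "6 * card (nonzeros i t) \<le> card (zeros i t)"
  shows "(\<integral>\<^sup>+w. indicator {0} (fst w t) * ennreal (evidence i (fst w) (snd w) t) \<partial>(prefs \<Otimes>\<^sub>M noises))
           \<le> ennreal (1/2)"
proof -
  interpret P: prob_space prefs by (rule prob_space_pref_seq)
  interpret N: prob_space noises by (rule prob_space_noise_seq)
  interpret PN: pair_prob_space prefs noises ..
  define ind :: "real \<Rightarrow> ennreal" where "ind = indicator {0}"
  define g where "g s = (if q s i = 0 then 9/10 else 17/10 :: real)" for s
  \<comment> \<open>Evidence before \<open>t\<close> is bounded through preferences before
    \<open>t\<close> alone, so coordinate \<open>t\<close> is free to carry the low-type indicator.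
    The integrand becomes a product over distinct coordinates.\<close>
  let ?v = "\<lambda>s. if s = t then ind else growth i s"
  have ev: "(\<lambda>w. ennreal (evidence i (fst w) (snd w) t)) \<in> borel_measurable (prefs \<Otimes>\<^sub>M noises)"
    using measurable_evidence[OF i] by (rule measurable_compose[OF _ measurable_ennreal])
  have "(\<lambda>w. fst w t) \<in> prefs \<Otimes>\<^sub>M noises \<rightarrow>\<^sub>M pref_law A"
    using t by (intro measurable_compose[OF measurable_fst measurable_component_singleton]) auto
  then have ind: "(\<lambda>w. ind (fst w t)) \<in> borel_measurable (prefs \<Otimes>\<^sub>M noises)"
    by (rule measurable_compose) simp
  have "(\<integral>\<^sup>+w. ind (fst w t) * ennreal (evidence i (fst w) (snd w) t) \<partial>(prefs \<Otimes>\<^sub>M noises))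
      = (\<integral>\<^sup>+\<theta>. \<integral>\<^sup>+\<epsilon>. ind (\<theta> t) * ennreal (evidence i \<theta> \<epsilon> t) \<partial>noises \<partial>prefs)"
    using N.nn_integral_fst[OF borel_measurable_times_ennreal[OF ind ev]] by (simp only: fst_conv snd_conv)
  also have "\<dots> \<le> (\<integral>\<^sup>+\<theta>. (\<Prod>s\<in>insert t {1..<t}. ?v s (\<theta> s)) \<partial>prefs)"
  proof (rule nn_integral_mono)
    fix \<theta> assume \<theta>: "\<theta> \<in> space prefs"
    have "(\<lambda>\<epsilon>. ennreal (evidence i \<theta> \<epsilon> t)) \<in> borel_measurable noises"
      using measurable_pair_noises[OF measurable_evidence[OF i] \<theta>]
      by (intro measurable_compose[OF _ measurable_ennreal]) (simp only: fst_conv snd_conv)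
    then have "(\<integral>\<^sup>+\<epsilon>. ind (\<theta> t) * ennreal (evidence i \<theta> \<epsilon> t) \<partial>noises) =
        ind (\<theta> t) * (\<integral>\<^sup>+\<epsilon>. ennreal (evidence i \<theta> \<epsilon> t) \<partial>noises)"
      by (rule nn_integral_cmult)
    also have "\<dots> \<le> ind (\<theta> t) * (\<Prod>s=1..<t. growth i s (\<theta> s))"
      by (intro mult_left_mono nn_integral_evidence i \<theta>) simp
    also have "(\<Prod>s=1..<t. growth i s (\<theta> s)) = (\<Prod>s=1..<t. ?v s (\<theta> s))"
      by (intro prod.cong) auto
    finally show "(\<integral>\<^sup>+\<epsilon>. ind (\<theta> t) * ennreal (evidence i \<theta> \<epsilon> t) \<partial>noises) \<le> (\<Prod>s\<in>insert t {1..<t}. ?v s (\<theta> s))"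
      by simp
  qed
  also have "\<dots> = (\<Prod>s\<in>insert t {1..<t}. \<integral>\<^sup>+y. ?v s y \<partial>pref_law A)"
    using t by (intro nn_integral_PiM_prod) (auto simp: measure_pmf.prob_space_axioms)
  also have "\<dots> = (\<integral>\<^sup>+y. ind y \<partial>pref_law A) * (\<Prod>s=1..<t. \<integral>\<^sup>+y. growth i s y \<partial>pref_law A)"
    by (subst prod.insert) (auto intro!: arg_cong2[where f = "(*)"] prod.cong)
  also have "(\<integral>\<^sup>+y. ind y \<partial>pref_law A) = ennreal (1/2)"
    using nn_integral_fair_bit[of "indicator {0}"] by (simp add: ind_def ennreal_indicator)
  also have "(\<Prod>s=1..<t. \<integral>\<^sup>+y. growth i s y \<partial>pref_law A) = (\<Prod>s=1..<t. ennreal (g s))"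
    by (intro prod.cong refl, simp only: growth_def lagging_market_sel, subst nn_integral_fair_bit)
      (auto simp: g_def)
  also have "\<dots> = ennreal (\<Prod>s=1..<t. g s)"
    by (intro prod_ennreal) (auto simp: g_def)
  also have "(\<Prod>s=1..<t. g s) = (9/10) ^ card (zeros i t) * (17/10) ^ card (nonzeros i t)"
    unfolding g_def by (subst prod.If_cases) (simp_all add: zeros_def nonzeros_def Int_def)
  also have "ennreal (1/2) * ennreal ((9/10) ^ card (zeros i t) * (17/10) ^ card (nonzeros i t)) \<le>
      ennreal (1/2) * ennreal 1"
  proof (intro mult_left_mono ennreal_leI)
    have "(9/10 :: real) ^ card (zeros i t) \<le> (9/10) ^ (6 * card (nonzeros i t))"
      using lag by (intro power_decreasing) auto
    then have "(9/10) ^ card (zeros i t) * (17/10) ^ card (nonzeros i t)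
        \<le> ((9/10 :: real) ^ (6 * card (nonzeros i t))) * (17/10) ^ card (nonzeros i t)"
      by (intro mult_right_mono) auto
    also have "\<dots> = ((9/10) ^ 6 * (17/10)) ^ card (nonzeros i t)"
      by (simp only: power_mult power_mult_distrib)
    also have "\<dots> \<le> 1"
      by (intro power_le_one) (simp_all add: power_divide)
    finally show "(9/10 :: real) ^ card (zeros i t) * (17/10) ^ card (nonzeros i t) \<le> 1" .
  qed simp
  finally show ?thesis by (simp add: ind_def)
qed

text \<open>By Markov's inequality: the expected posterior mean of the number of good components is at most
  \<open>d/2 + d/4\<close>, below the purchase threshold \<open>7d/8\<close> of the low type.\<close>

lemma no_purchase_probability:
  assumes M: "M > 0" and d: "d \<ge> 1" and t: "t \<ge> 1"
    and lag: "d \<le> 2 * card {i \<in> {1..d}. 6 * card (nonzeros i t) \<le> card (zeros i t)}"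
  shows "ennreal (1/14) \<le> emeasure (prefs \<Otimes>\<^sub>M noises)
    {w \<in> space (prefs \<Otimes>\<^sub>M noises). fst w t = 0 \<and> \<not> buys A (belief (fst w) (snd w) t) (fst w t)}"
    (is "_ \<le> emeasure ?R ?E")
proof -
  interpret P: prob_space prefs by (rule prob_space_pref_seq)
  interpret N: prob_space noises by (rule prob_space_noise_seq)
  interpret PN: pair_prob_space prefs noises ..
  define L where "L = {i \<in> {1..d}. 6 * card (nonzeros i t) \<le> card (zeros i t)}"
  define ind :: "real \<Rightarrow> ennreal" where "ind = indicator {0}"
  \<comment> \<open>The reciprocal of the purchase threshold 7d/8.\<close>
  define a where "a = ennreal (8 / (7 * real d))"
  define X where "X i w = ennreal (mean_component i (fst w) (snd w) t)" for i w
  have comp: "(\<lambda>w. fst w t) \<in> ?R \<rightarrow>\<^sub>M pref_law A"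
    using t by (intro measurable_compose[OF measurable_fst measurable_component_singleton]) auto
  then have ind[measurable]: "(\<lambda>w. ind (fst w t)) \<in> borel_measurable ?R"
    by (rule measurable_compose) simp
  have X[measurable]: "X i \<in> borel_measurable ?R" for i
    unfolding X_def mean_component_def
    by (intro measurable_compose[OF _ measurable_ennreal] borel_measurable_sum borel_measurable_times
        measurable_path_belief measurable_const) auto
  have [measurable]: "?E \<in> sets ?R"
  proof -
    have "Measurable.pred ?R (\<lambda>w. fst w t = 0)"
      using comp by (rule measurable_compose) simp
    moreover have "Measurable.pred ?R (\<lambda>w. buys A (belief (fst w) (snd w) t) (fst w t))"
      using measurable_path_belief(2)[OF t] by simp
    ultimately show ?thesis
      unfolding pred_def by (intro sets.sets_Collect_conj sets.sets_Collect_neg)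
  qed
  have half: "(\<integral>\<^sup>+w. ind (fst w t) \<partial>?R) = ennreal (1/2)"
  proof -
    have "(\<integral>\<^sup>+w. ind (fst w t) \<partial>?R) = (\<integral>\<^sup>+\<theta>. \<integral>\<^sup>+\<epsilon>. ind (\<theta> t) \<partial>noises \<partial>prefs)"
      using N.nn_integral_fst[OF ind] by (simp only: fst_conv)
    also have "\<dots> = (\<integral>\<^sup>+\<theta>. (\<Prod>s\<in>{t}. ind (\<theta> s)) \<partial>prefs)"
      by (simp add: N.emeasure_space_1 del: lagging_market_sel)
    also have "\<dots> = (\<Prod>s\<in>{t}. \<integral>\<^sup>+y. ind y \<partial>pref_law A)"
      using t by (intro nn_integral_PiM_prod) (auto simp: measure_pmf.prob_space_axioms)
    also have "\<dots> = ennreal (1/2)"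
      using nn_integral_fair_bit[of "indicator {0}"] by (simp add: ind_def ennreal_indicator)
    finally show ?thesis .
  qed
  \<comment> \<open>A lagging component gets 1/2 from \<open>mean_component_bounds\<close> times 1/2
    from the mean evidence. For any other one the mean is bounded by 1, which leaves the probability
    1/2 of a low type.\<close>
  have "(\<integral>\<^sup>+w. ind (fst w t) * X i w \<partial>?R) \<le> ennreal (if i \<in> L then 1/4 else 1/2)" if i: "i \<in> {1..d}" for i
  proof (cases "i \<in> L")
    case True
    have "(\<integral>\<^sup>+w. ind (fst w t) * X i w \<partial>?R) \<le>
        (\<integral>\<^sup>+w. ennreal (1/2) * (ind (fst w t) * ennreal (evidence i (fst w) (snd w) t)) \<partial>?R)"
    proof (intro nn_integral_mono)
      fix w
      have "X i w \<le> ennreal (1/2 * evidence i (fst w) (snd w) t)"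
        unfolding X_def using mean_component_bounds(3)[OF i] by (intro ennreal_leI) simp
      also have "\<dots> = ennreal (1/2) * ennreal (evidence i (fst w) (snd w) t)"
        by (rule ennreal_mult') simp
      finally have "ind (fst w t) * X i w \<le>
          ind (fst w t) * (ennreal (1/2) * ennreal (evidence i (fst w) (snd w) t))"
        by (rule mult_left_mono) simp
      then show "ind (fst w t) * X i w \<le>
          ennreal (1/2) * (ind (fst w t) * ennreal (evidence i (fst w) (snd w) t))"
        by (simp only: mult.left_commute)
    qed
    also have "\<dots> = ennreal (1/2) * (\<integral>\<^sup>+w. ind (fst w t) * ennreal (evidence i (fst w) (snd w) t) \<partial>?R)"
      by (intro nn_integral_cmult borel_measurable_times_ennreal ind
          measurable_compose[OF measurable_evidence[OF i] measurable_ennreal])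
    also have "\<dots> \<le> ennreal (1/2) * ennreal (1/2)"
      unfolding ind_def using True i t
      by (intro mult_left_mono nn_integral_low_type_evidence) (auto simp: L_def)
    also have "\<dots> = ennreal (1/2 * (1/2))" by (rule ennreal_mult'[symmetric]) simp
    finally show ?thesis using True by simp
  next
    case False
    have "(\<integral>\<^sup>+w. ind (fst w t) * X i w \<partial>?R) \<le> (\<integral>\<^sup>+w. ind (fst w t) * 1 \<partial>?R)"
      using mean_component_bounds(2)[OF i]
      by (intro nn_integral_mono mult_left_mono) (auto simp: X_def ennreal_le_1)
    then show ?thesis using half False by simp
  qed
  then have "(\<Sum>i=1..d. \<integral>\<^sup>+w. ind (fst w t) * X i w \<partial>?R) \<le> (\<Sum>i=1..d. ennreal (if i \<in> L then 1/4 else 1/2))"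
    by (intro sum_mono)
  also have "\<dots> = ennreal (\<Sum>i=1..d. if i \<in> L then 1/4 else 1/2)"
    by (intro sum_ennreal) auto
  also have "\<dots> \<le> ennreal (3/8 * real d)"
  proof (rule ennreal_leI)
    have L: "L \<subseteq> {1..d}" by (auto simp: L_def)
    then have card: "real (card ({1..d} - L)) = real d - real (card L)"
      using card_mono[OF _ L] by (simp add: card_Diff_subset finite_subset of_nat_diff)
    have "(\<Sum>i=1..d. if i \<in> L then 1/4 else 1/2 :: real) = 1/4 * real (card L) + 1/2 * real (card ({1..d} - L))"
      using L by (subst sum.If_cases) (auto simp: Int_absorb1 Diff_eq)
    also have "\<dots> \<le> 3/8 * real d"
      unfolding card using lag[folded L_def] by (simp add: field_simps)
    finally show "(\<Sum>i=1..d. if i \<in> L then 1/4 else 1/2 :: real) \<le> 3/8 * real d" .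
  qed
  finally have sum_X: "(\<Sum>i=1..d. \<integral>\<^sup>+w. ind (fst w t) * X i w \<partial>?R) \<le> ennreal (3/8 * real d)" .
  have "ennreal (1/2) = (\<integral>\<^sup>+w. ind (fst w t) \<partial>?R)" by (rule half[symmetric])
  \<comment> \<open>Markov's inequality pointwise: a low type either refuses, or the scaled
    posterior mean is at least 1.\<close>
  also have "\<dots> \<le> (\<integral>\<^sup>+w. indicator ?E w + a * (\<Sum>i=1..d. ind (fst w t) * X i w) \<partial>?R)"
  proof (rule nn_integral_mono)
    fix w assume w: "w \<in> space ?R"
    show "ind (fst w t) \<le> indicator ?E w + a * (\<Sum>i=1..d. ind (fst w t) * X i w)"
    proof (cases "fst w t = 0 \<and> w \<notin> ?E")
      case True
      then have "buys A (belief (fst w) (snd w) t) (fst w t)" using w by simp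
      then have "7/8 * real d \<le> (\<Sum>i=1..d. mean_component i (fst w) (snd w) t)"
        using True by (subst (asm) buys_low[OF M]) auto
      then have "1 \<le> 8 / (7 * real d) * (\<Sum>i=1..d. mean_component i (fst w) (snd w) t)"
        using d by (simp add: field_simps)
      then have "1 \<le> ennreal (8 / (7 * real d) * (\<Sum>i=1..d. mean_component i (fst w) (snd w) t))"
        by simp
      also have "\<dots> = a * ennreal (\<Sum>i=1..d. mean_component i (fst w) (snd w) t)"
        unfolding a_def by (rule ennreal_mult') simp
      also have "ennreal (\<Sum>i=1..d. mean_component i (fst w) (snd w) t) = (\<Sum>i=1..d. X i w)"
        unfolding X_def by (rule sum_ennreal[symmetric]) (rule mean_component_bounds(1))
      finally show ?thesis using True by (simp add: ind_def)
    qed (use w in \<open>auto simp: ind_def indicator_def\<close>)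
  qed
  also have "\<dots> = emeasure ?R ?E + a * (\<Sum>i=1..d. \<integral>\<^sup>+w. ind (fst w t) * X i w \<partial>?R)"
  proof -
    have m: "(\<lambda>w. \<Sum>i=1..d. ind (fst w t) * X i w) \<in> borel_measurable ?R"
      by (intro borel_measurable_sum borel_measurable_times_ennreal ind X)
    have "(\<integral>\<^sup>+w. (\<Sum>i=1..d. ind (fst w t) * X i w) \<partial>?R) = (\<Sum>i=1..d. \<integral>\<^sup>+w. ind (fst w t) * X i w \<partial>?R)"
      by (intro nn_integral_sum borel_measurable_times_ennreal ind X)
    moreover have "(\<integral>\<^sup>+w. indicator ?E w + a * (\<Sum>i=1..d. ind (fst w t) * X i w) \<partial>?R)
        = (\<integral>\<^sup>+w. indicator ?E w \<partial>?R) + (\<integral>\<^sup>+w. a * (\<Sum>i=1..d. ind (fst w t) * X i w) \<partial>?R)"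
      by (rule nn_integral_add) (use m in measurable)
    moreover have "(\<integral>\<^sup>+w. indicator ?E w \<partial>?R) = emeasure ?R ?E"
      by (rule nn_integral_indicator) measurable
    ultimately show ?thesis
      by (simp only: nn_integral_cmult[OF m])
  qed
  also have "\<dots> \<le> emeasure ?R ?E + a * ennreal (3/8 * real d)"
    by (intro add_left_mono mult_left_mono sum_X) simp
  \<comment> \<open>Low types have probability 1/2, and at most 3/7 of it can be lost to purchases;
    1/2 - 3/7 = 1/14.\<close>
  also have "a * ennreal (3/8 * real d) = ennreal (3/7)"
    using d by (simp add: a_def field_simps flip: ennreal_mult')
  also have "emeasure ?R ?E = ennreal (PN.prob ?E)" by (rule PN.emeasure_eq_measure)
  also have "ennreal (PN.prob ?E) + ennreal (3/7) = ennreal (PN.prob ?E + 3/7)"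
    by (rule ennreal_plus[symmetric]) (rule measure_nonneg, simp)
  finally have half_le: "ennreal (1/2) \<le> ennreal (PN.prob ?E + 3/7)" .
  have "0 \<le> PN.prob ?E + 3/7"
    by (rule add_nonneg_nonneg[OF measure_nonneg]) simp
  from half_le[unfolded ennreal_le_iff[OF this]] have "1/14 \<le> PN.prob ?E"
    by linarith
  then show ?thesis
    unfolding PN.emeasure_eq_measure by (rule ennreal_leI)
qed

end

section \<open>The quality chain and the probability space\<close>

definition ones :: "nat \<Rightarrow> vec" where
  "ones d = (\<lambda>i\<in>{1..d}. 1)"

definition jump_matrix :: "nat \<Rightarrow> real \<Rightarrow> vec \<Rightarrow> vec \<Rightarrow> real" where
  "jump_matrix d \<rho> q q' =
     (if q = ones d then of_bool (q' = ones d)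
      else if q' = q then 1 - \<rho> else if q' = ones d then \<rho> else 0)"

text \<open>The seed \<open>(q, g)\<close> is the initial state and the number of further periods spent there, so the
  chain jumps at time \<open>g + 2\<close>.\<close>

fun jump_path :: "nat \<Rightarrow> vec \<times> nat \<Rightarrow> nat \<Rightarrow> vec" where
  "jump_path d (q, g) = (\<lambda>s\<in>{1..}. if s < g + 2 \<and> q \<in> cube d then q else ones d)"

definition seed_law :: "nat \<Rightarrow> real \<Rightarrow> (vec \<times> nat) pmf" where
  "seed_law d \<rho> = pair_pmf (pmf_of_set (cube d)) (geometric_pmf \<rho>)"

definition path_law :: "nat \<Rightarrow> real \<Rightarrow> (nat \<Rightarrow> vec) measure" where
  "path_law d \<rho> = distr (seed_law d \<rho>) (PiM {1..} (\<lambda>_. count_space (cube d))) (jump_path d)"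

lemma ones_cube [simp]: "ones d \<in> cube d"
  by (simp add: ones_def cube_def)

text \<open>The default \<open>ones d\<close> for seeds outside the cube makes this true for all
  seeds and not only for almost all.\<close>

lemma jump_path_cube: "s \<ge> 1 \<Longrightarrow> jump_path d x s \<in> cube d"
  by (cases x) simp

lemma jump_path_space: "jump_path d x \<in> space (PiM {1..} (\<lambda>_. count_space (cube d)))"
  by (cases x) (simp add: space_PiM)

lemma measurable_jump_path [measurable]:
  "jump_path d \<in> measure_pmf p \<rightarrow>\<^sub>M PiM {1..} (\<lambda>_. count_space (cube d))"
  using jump_path_space by simp

lemma jump_matrix_transition:
  assumes "0 < \<rho>" "\<rho> < 1"
  shows "transition_matrix d (jump_matrix d \<rho>)"
  unfolding transition_matrix_def distributions_def
proof (intro ballI CollectI conjI)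
  fix q q' assume "q \<in> cube d" "q' \<in> cube d"
  show "0 \<le> jump_matrix d \<rho> q q'" using assms by (simp add: jump_matrix_def)
next
  fix q assume q: "q \<in> cube d"
  show "(\<Sum>q'\<in>cube d. jump_matrix d \<rho> q q') = 1"
  proof (cases "q = ones d")
    case True
    then show ?thesis by (simp add: jump_matrix_def of_bool_def)
  next
    case False
    have "(\<Sum>q'\<in>cube d. jump_matrix d \<rho> q q') =
        (\<Sum>q'\<in>cube d. (if q' = q then 1 - \<rho> else 0) + (if q' = ones d then \<rho> else 0))"
      using False by (intro sum.cong) (auto simp: jump_matrix_def)
    also have "\<dots> = 1" using q by (simp add: sum.distrib)
    finally show ?thesis .
  qed
qed

lemma jump_matrix_diag: "0 \<le> \<rho> \<Longrightarrow> 1 - \<rho> \<le> jump_matrix d \<rho> q q"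
  by (simp add: jump_matrix_def)

lemma geometric_tail:
  assumes "0 < \<rho>" "\<rho> < 1"
  shows "measure (geometric_pmf \<rho>) {n..} = (1 - \<rho>) ^ n"
proof (induction n)
  case 0
  show ?case by (simp add: atLeast_0)
next
  case (Suc n)
  have "{n..} = insert n {Suc n..}" by auto
  then have "measure (geometric_pmf \<rho>) {n..} = pmf (geometric_pmf \<rho>) n + measure (geometric_pmf \<rho>) {Suc n..}"
    using measure_pmf.finite_measure_Union[of "{n}" "geometric_pmf \<rho>" "{Suc n..}"]
    by (simp add: measure_pmf_single)
  then show ?case using Suc assms by (simp add: algebra_simps)
qed

lemma prob_seed_Times:
  assumes "q \<in> cube d"
  shows "measure (seed_law d \<rho>) ({q} \<times> B) = measure (geometric_pmf \<rho>) B / 2 ^ d"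
  unfolding seed_law_def using assms
  by (subst measure_pmf_prob_product) (auto simp: measure_pmf_single intro: countable_subset[OF subset_UNIV])

text \<open>From the absorbing state the next step is forced. From any other state y the history
  must be constantly y, so the event concerns only the geometric time, and the Markov property is
  its memorylessness.\<close>

lemma jump_path_chain:
  assumes \<rho>: "0 < \<rho>" "\<rho> < 1" and t: "t \<ge> 1" and h: "\<And>s. s \<in> {1..Suc t} \<Longrightarrow> h s \<in> cube d"
  shows "measure (seed_law d \<rho>) {x. \<forall>s\<in>{1..Suc t}. jump_path d x s = h s} =
         measure (seed_law d \<rho>) {x. \<forall>s\<in>{1..t}. jump_path d x s = h s} * jump_matrix d \<rho> (h t) (h (Suc t))"
proof -
  let ?E = "\<lambda>t. {x. \<forall>s\<in>{1..t}. jump_path d x s = h s}"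
  have atLeastAtMost_Suc: "{1..Suc t} = insert (Suc t) {1..t}" using t by auto
  show ?thesis
  proof (cases "h t = ones d")
    case True
    have "jump_path d x (Suc t) = ones d" if "jump_path d x t = ones d" for x
      using that t by (cases x) (auto split: if_splits)
    then have "jump_path d x (Suc t) = ones d" if "x \<in> ?E t" for x
      using that True t by auto
    then have "?E (Suc t) = (if h (Suc t) = ones d then ?E t else {})"
      unfolding atLeastAtMost_Suc by (auto simp del: jump_path.simps)
    then show ?thesis using True by (simp add: jump_matrix_def)
  next
    case False
    define y where "y = h t"
    have y: "y \<in> cube d" "y \<noteq> ones d" using h[of t] t False by (auto simp: y_def)
    have path_y: "jump_path d x t = y \<longleftrightarrow> fst x = y \<and> t < snd x + 2" for x
      using y t by (cases x) auto
    have before: "jump_path d (y, g) s = y" if "1 \<le> s" "s < g + 2" for s g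
      using y that by simp
    show ?thesis
    proof (cases "\<forall>s\<in>{1..t}. h s = y")
      case const: True
      \<comment> \<open>Being at y at time \<open>t\<close> means \<open>t < g + 2\<close>, that is,
        \<open>g \<ge> t - 1\<close>.\<close>
      have Et: "?E t = {y} \<times> {t - 1..}"
      proof (intro set_eqI iffI)
        fix x assume "x \<in> ?E t"
        then have "jump_path d x t = y" using t by (simp add: y_def)
        then show "x \<in> {y} \<times> {t - 1..}" unfolding path_y by (cases x) auto
      next
        fix x assume "x \<in> {y} \<times> {t - 1..}"
        then obtain g where "x = (y, g)" "t - 1 \<le> g" by auto
        then show "x \<in> ?E t" using const by (auto simp del: jump_path.simps intro!: before)
      qed
      have next_state: "jump_path d (y, g) (Suc t) = (if Suc t < g + 2 then y else ones d)" for g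
        using y t by simp
      have "?E (Suc t) = {x \<in> ?E t. jump_path d x (Suc t) = h (Suc t)}"
        unfolding atLeastAtMost_Suc by auto
      also have "\<dots> = {y} \<times> {g. t - 1 \<le> g \<and> (if Suc t < g + 2 then y else ones d) = h (Suc t)}"
        unfolding Et
        by (rule set_eqI, rename_tac x, case_tac x) (simp add: next_state del: jump_path.simps cong: conj_cong)
      \<comment> \<open>Staying one more period shifts the tail by one; leaving at the next step
        pins \<open>g\<close> to \<open>t - 1\<close>.\<close>
      also have "{g. t - 1 \<le> g \<and> (if Suc t < g + 2 then y else ones d) = h (Suc t)} =
          (if h (Suc t) = y then {t..} else if h (Suc t) = ones d then {t - 1} else {})"
        using y t by (auto split: if_splits)
      finally have ESuc: "?E (Suc t) = {y} \<times>
          (if h (Suc t) = y then {t..} else if h (Suc t) = ones d then {t - 1} else {})" .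
      have "(1 - \<rho>) ^ t = (1 - \<rho>) ^ (t - 1) * (1 - \<rho>)"
        using t by (metis Suc_diff_le diff_Suc_1 power_Suc2 One_nat_def)
      then show ?thesis
        unfolding ESuc Et prob_seed_Times[OF y(1)] y_def[symmetric]
        using y \<rho> by (auto simp: jump_matrix_def geometric_tail measure_pmf_single)
    next
      case nonconst: False
      have empty: "?E t = {}"
      proof (intro equals0I)
        fix x assume x: "x \<in> ?E t"
        then have "jump_path d x t = y" using t unfolding y_def mem_Collect_eq by (elim bspec) simp
        then have "fst x = y \<and> t < snd x + 2" by (rule path_y[THEN iffD1])
        then have "\<forall>s\<in>{1..t}. jump_path d x s = y" by (cases x) (auto simp del: jump_path.simps intro!: before)
        then show False using x nonconst by auto
      qed
      moreover have "?E (Suc t) \<subseteq> ?E t" by (auto simp del: jump_path.simps)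
      ultimately have "?E (Suc t) = {}" by (simp only: subset_empty)
      then show ?thesis unfolding empty by (simp only: measure_empty mult_zero_left)
    qed
  qed
qed

lemma prob_space_path_law: "prob_space (path_law d \<rho>)"
  unfolding path_law_def by (rule measure_pmf.prob_space_distr) measurable

lemma sets_path_law: "sets (path_law d \<rho>) = sets (PiM {1..} (\<lambda>_. count_space (cube d)))"
  by (simp add: path_law_def)

definition world :: "nat \<Rightarrow> real \<Rightarrow> real \<Rightarrow> ((nat \<Rightarrow> vec) \<times> (nat \<Rightarrow> real) \<times> (nat \<Rightarrow> vec)) measure" where
  "world d M \<rho> = path_law d \<rho> \<Otimes>\<^sub>M
     (PiM {1..} (\<lambda>_. pref_law (lagging_market d M)) \<Otimes>\<^sub>M PiM {1..} (\<lambda>_. noise_law (lagging_market d M)))"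

text \<open>Moves the finite-dimensional laws of the chain from the big product space to the
  discrete seed.\<close>

lemma prob_world:
  assumes "t \<ge> 1"
  shows "\<P>(\<omega> in world d M \<rho>. \<forall>s\<in>{1..t}. fst \<omega> s = h s) =
         measure (seed_law d \<rho>) {x. \<forall>s\<in>{1..t}. jump_path d x s = h s}"
proof -
  let ?A = "lagging_market d M"
  let ?R = "PiM {1::nat..} (\<lambda>_. pref_law ?A) \<Otimes>\<^sub>M PiM {1::nat..} (\<lambda>_. noise_law ?A)"
  interpret M2: prob_space "PiM {1::nat..} (\<lambda>_. pref_law ?A)" by (rule prob_space_pref_seq)
  interpret M3: prob_space "PiM {1::nat..} (\<lambda>_. noise_law ?A)" by (rule prob_space_noise_seq)
  interpret R: pair_prob_space "PiM {1::nat..} (\<lambda>_. pref_law ?A)" "PiM {1::nat..} (\<lambda>_. noise_law ?A)" ..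
  let ?S = "{p \<in> space (path_law d \<rho>). \<forall>s\<in>{1..t}. p s = h s}"
  have "Measurable.pred (PiM {1..} (\<lambda>_. count_space (cube d))) (\<lambda>p. p s = h s)" if "s \<in> {1..t}" for s
  proof -
    have "(\<lambda>p. p s) \<in> PiM {1..} (\<lambda>_. count_space (cube d)) \<rightarrow>\<^sub>M count_space (cube d)"
      using that by (intro measurable_component_singleton) auto
    then show ?thesis by (rule measurable_compose) simp
  qed
  then have "Measurable.pred (PiM {1..} (\<lambda>_. count_space (cube d))) (\<lambda>p. \<forall>s\<in>{1..t}. p s = h s)"
    by (intro pred_intros_finite) auto
  then have S: "?S \<in> sets (path_law d \<rho>)"
    by (simp add: path_law_def pred_def)
  have "\<P>(\<omega> in world d M \<rho>. \<forall>s\<in>{1..t}. fst \<omega> s = h s) = measure (distr (world d M \<rho>) (path_law d \<rho>) fst) ?S"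
    using S by (subst measure_distr)
      (auto simp: world_def space_pair_measure intro!: arg_cong[where f = "measure _"])
  also have "distr (world d M \<rho>) (path_law d \<rho>) fst = path_law d \<rho>"
    unfolding world_def by (rule R.distr_pair_fst)
  also have "measure (path_law d \<rho>) ?S = measure (seed_law d \<rho>) (jump_path d -` ?S)"
    using S unfolding path_law_def
    by (subst measure_distr) (simp_all only: measurable_jump_path sets_distr space_measure_pmf Int_UNIV_right)
  also have "jump_path d -` ?S = {x. \<forall>s\<in>{1..t}. jump_path d x s = h s}"
    using jump_path_space by (auto simp: path_law_def simp del: jump_path.simps)
  finally show ?thesis .
qed

lemma world_dynamics:
  assumes \<rho>: "0 < \<rho>" "\<rho> < 1"
  shows "market_dynamics (lagging_market d M) (jump_matrix d \<rho>) (world d M \<rho>)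
    (\<lambda>t \<omega>. fst \<omega> t) (\<lambda>t \<omega>. fst (snd \<omega>) t) (\<lambda>t \<omega>. snd (snd \<omega>) t)"
proof -
  let ?A = "lagging_market d M"
  let ?P = "PiM {1::nat..} (\<lambda>_. pref_law ?A)" and ?N = "PiM {1::nat..} (\<lambda>_. noise_law ?A)"
  interpret M1: prob_space "path_law d \<rho>" by (rule prob_space_path_law)
  interpret M2: prob_space ?P by (rule prob_space_pref_seq)
  interpret M3: prob_space ?N by (rule prob_space_noise_seq)
  interpret R: pair_prob_space ?P ?N ..
  interpret W: pair_prob_space "path_law d \<rho>" "?P \<Otimes>\<^sub>M ?N" ..
  have W: "prob_space (world d M \<rho>)" unfolding world_def by (rule W.prob_space_axioms)
  have chain: "markov_chain d (jump_matrix d \<rho>) (world d M \<rho>) (\<lambda>t \<omega>. fst \<omega> t)"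
    unfolding markov_chain_def
  proof (intro conjI allI impI ballI)
    fix t :: nat assume "t \<ge> 1"
    then have "(\<lambda>p. p t) \<in> path_law d \<rho> \<rightarrow>\<^sub>M count_space (cube d)"
      unfolding path_law_def by simp
    then show "(\<lambda>\<omega>. fst \<omega> t) \<in> world d M \<rho> \<rightarrow>\<^sub>M count_space (cube d)"
      unfolding world_def by (rule measurable_compose[OF measurable_fst])
  next
    fix q assume q: "q \<in> cube d"
    have "\<P>(\<omega> in world d M \<rho>. fst \<omega> 1 = q) = measure (seed_law d \<rho>) {x. jump_path d x 1 = q}"
      using prob_world[of 1 d M \<rho> "\<lambda>_. q"] by simp
    \<comment> \<open>Only almost surely: seeds outside the cube also start in
      \<open>ones d\<close>, but have probability 0.\<close>
    also have "\<dots> = measure (seed_law d \<rho>) ({q} \<times> UNIV)"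
    proof (rule measure_pmf.finite_measure_eq_AE)
      show "AE x in seed_law d \<rho>. x \<in> {x. jump_path d x 1 = q} \<longleftrightarrow> x \<in> {q} \<times> UNIV"
        by (auto simp: AE_measure_pmf_iff seed_law_def)
    qed auto
    also have "\<dots> = uniform_prior d q"
      unfolding prob_seed_Times[OF q] by (simp add: uniform_prior_def)
    finally show "\<P>(\<omega> in world d M \<rho>. fst \<omega> 1 = q) = uniform_prior d q" .
  next
    fix t h assume "t \<ge> (1::nat)" "\<forall>s\<in>{1..Suc t}. h s \<in> cube d"
    then show "\<P>(\<omega> in world d M \<rho>. \<forall>s\<in>{1..Suc t}. fst \<omega> s = h s) =
        \<P>(\<omega> in world d M \<rho>. \<forall>s\<in>{1..t}. fst \<omega> s = h s) * jump_matrix d \<rho> (h t) (h (Suc t))"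
      using \<rho> by (subst (1 2) prob_world) (auto intro!: jump_path_chain simp del: jump_path.simps)
  qed
  have prefs: "iid_sequence (pref_law ?A) (world d M \<rho>) (\<lambda>t \<omega>. fst (snd \<omega>) t)"
  proof (rule iid_sequence_PiM[where p = "\<lambda>\<omega>. fst (snd \<omega>)"])
    show m: "(\<lambda>\<omega>. fst (snd \<omega>)) \<in> world d M \<rho> \<rightarrow>\<^sub>M ?P"
      unfolding world_def by (rule measurable_compose[OF measurable_snd measurable_fst])
    have "distr (world d M \<rho>) ?P (\<lambda>\<omega>. fst (snd \<omega>)) = distr (distr (world d M \<rho>) (?P \<Otimes>\<^sub>M ?N) snd) ?P fst"
      unfolding world_def by (subst distr_distr) (auto simp: comp_def)
    also have "\<dots> = ?P"
      unfolding world_def distr_pair_snd[OF prob_space_path_law R.sigma_finite_measure_axioms] by (rule M3.distr_pair_fst)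
    finally show "distr (world d M \<rho>) ?P (\<lambda>\<omega>. fst (snd \<omega>)) = ?P" .
  qed (use W in \<open>simp_all add: measure_pmf.prob_space_axioms\<close>)
  have noises: "iid_sequence (noise_law ?A) (world d M \<rho>) (\<lambda>t \<omega>. snd (snd \<omega>) t)"
  proof (rule iid_sequence_PiM[where p = "\<lambda>\<omega>. snd (snd \<omega>)"])
    show m: "(\<lambda>\<omega>. snd (snd \<omega>)) \<in> world d M \<rho> \<rightarrow>\<^sub>M ?N"
      unfolding world_def by (rule measurable_compose[OF measurable_snd measurable_snd])
    have "distr (world d M \<rho>) ?N (\<lambda>\<omega>. snd (snd \<omega>)) = distr (distr (world d M \<rho>) (?P \<Otimes>\<^sub>M ?N) snd) ?N snd"
      unfolding world_def by (subst distr_distr) (auto simp: comp_def)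
    also have "\<dots> = ?N"
      unfolding world_def distr_pair_snd[OF prob_space_path_law R.sigma_finite_measure_axioms]
      by (rule distr_pair_snd[OF M2.prob_space_axioms M3.sigma_finite_measure_axioms])
    finally show "distr (world d M \<rho>) ?N (\<lambda>\<omega>. snd (snd \<omega>)) = ?N" .
  qed (use W in \<open>simp_all add: measure_pmf.prob_space_axioms\<close>)
  have indep: "prob_space.indep_sets (world d M \<rho>)
       (\<lambda>k. [sequence_events (count_space (qualities ?A)) (world d M \<rho>) (\<lambda>t \<omega>. fst \<omega> t),
             sequence_events (pref_law ?A) (world d M \<rho>) (\<lambda>t \<omega>. fst (snd \<omega>) t),
             sequence_events (noise_law ?A) (world d M \<rho>) (\<lambda>t \<omega>. snd (snd \<omega>) t)] ! k) {..<3}"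
    unfolding world_def lagging_market_sel(1)
    by (rule indep_sequence_events[OF M1.prob_space_axioms M2.prob_space_axioms M3.prob_space_axioms sets_path_law refl refl])
  show ?thesis
    unfolding market_dynamics_def lagging_market_sel(1)
    using W chain prefs noises indep by (simp only: lagging_market_sel(1))
qed

section \<open>Regret\<close>

text \<open>Beliefs keep full support on the cube along every path, so Bayes' rule is defined
  surely.\<close>

lemma world_naive_update_defined:
  "naive_update_defined (lagging_market d M) (world d M \<rho>)
    (\<lambda>t \<omega>. fst \<omega> t) (\<lambda>t \<omega>. fst (snd \<omega>) t) (\<lambda>t \<omega>. snd (snd \<omega>) t)"
  unfolding naive_update_defined_def
proof (rule AE_I2, intro allI impI)
  fix \<omega> t assume \<omega>: "\<omega> \<in> space (world d M \<rho>)" and t: "t \<ge> (1::nat)"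
  interpret lagging_path d M "fst \<omega>"
    using \<omega> by unfold_locales (auto simp: world_def space_pair_measure path_law_def space_PiM)
  show "G_mean (lagging_market d M) (naive_review (lagging_market d M) (\<lambda>s. fst \<omega> s)
      (\<lambda>s. fst (snd \<omega>) s) (\<lambda>s. snd (snd \<omega>) s) t)
    (naive_belief (lagging_market d M) (\<lambda>s. fst \<omega> s) (\<lambda>s. fst (snd \<omega>) s) (\<lambda>s. snd (snd \<omega>) s) t) \<noteq> 0"
    by (rule review_possible[OF t])
qed

definition world_loss :: "nat \<Rightarrow> real \<Rightarrow> nat \<Rightarrow> (nat \<Rightarrow> vec) \<times> (nat \<Rightarrow> real) \<times> (nat \<Rightarrow> vec) \<Rightarrow> real" where
  "world_loss d M t \<omega> =
     max (reward (lagging_market d M) (fst \<omega> t) (fst (snd \<omega>) t)) 0 -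
     naive_utility (lagging_market d M) (fst \<omega>) (fst (snd \<omega>)) (snd (snd \<omega>)) t"

definition world_regret :: "nat \<Rightarrow> real \<Rightarrow> real \<Rightarrow> nat \<Rightarrow> real" where
  "world_regret d M \<rho> T = naive_regret (lagging_market d M) (world d M \<rho>)
    (\<lambda>t \<omega>. fst \<omega> t) (\<lambda>t \<omega>. fst (snd \<omega>) t) (\<lambda>t \<omega>. snd (snd \<omega>) t) T"

lemma world_regret_eq: "world_regret d M \<rho> T = (\<Sum>t=1..T. \<integral>\<omega>. world_loss d M t \<omega> \<partial>world d M \<rho>)"
  by (simp add: world_regret_def naive_regret_def world_loss_def del: lagging_market_sel)

lemma world_loss_nonneg: "world_loss d M t \<omega> \<ge> 0"
  by (simp add: world_loss_def naive_utility_def del: lagging_market_sel)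

lemma world_loss_integral_nonneg: "(\<integral>\<omega>. world_loss d M t \<omega> \<partial>world d M \<rho>) \<ge> 0"
  by (rule Bochner_Integration.integral_nonneg) (rule world_loss_nonneg)

lemma measurable_world:
  assumes "t \<ge> 1"
  shows "(\<lambda>\<omega>. fst \<omega> t i) \<in> borel_measurable (world d M \<rho>)"
    and "(\<lambda>\<omega>. fst (snd \<omega>) t) \<in> borel_measurable (world d M \<rho>)"
    and "(\<lambda>\<omega>. snd (snd \<omega>) t i) \<in> borel_measurable (world d M \<rho>)"
proof -
  let ?A = "lagging_market d M"
  let ?P = "PiM {1::nat..} (\<lambda>_. pref_law ?A)" and ?N = "PiM {1::nat..} (\<lambda>_. noise_law ?A)"
  have "(\<lambda>p. p t) \<in> path_law d \<rho> \<rightarrow>\<^sub>M count_space (cube d)"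
    unfolding path_law_def using assms by simp
  then have "(\<lambda>p. p t i) \<in> borel_measurable (path_law d \<rho>)"
    by (rule measurable_compose) simp
  then show "(\<lambda>\<omega>. fst \<omega> t i) \<in> borel_measurable (world d M \<rho>)"
    unfolding world_def by (rule measurable_compose[OF measurable_fst])
  have "(\<lambda>p. p t) \<in> ?P \<rightarrow>\<^sub>M pref_law ?A"
    using assms by (intro measurable_component_singleton) simp
  then have "(\<lambda>p. p t) \<in> borel_measurable ?P"
    by (rule measurable_compose) simp
  then show "(\<lambda>\<omega>. fst (snd \<omega>) t) \<in> borel_measurable (world d M \<rho>)"
    unfolding world_def
    by (rule measurable_compose[OF measurable_compose[OF measurable_snd measurable_fst]])
  have "(\<lambda>p. p t) \<in> ?N \<rightarrow>\<^sub>M noise_law ?A"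
    using assms by (intro measurable_component_singleton) simp
  then have "(\<lambda>p. p t i) \<in> borel_measurable ?N"
    by (rule measurable_compose) simp
  then show "(\<lambda>\<omega>. snd (snd \<omega>) t i) \<in> borel_measurable (world d M \<rho>)"
    unfolding world_def
    by (rule measurable_compose[OF measurable_compose[OF measurable_snd measurable_snd]])
qed

lemma world_path_cube: "\<omega> \<in> space (world d M \<rho>) \<Longrightarrow> t \<ge> 1 \<Longrightarrow> fst \<omega> t \<in> cube d"
  by (auto simp: world_def space_pair_measure path_law_def space_PiM)

lemma measurable_world_buys:
  assumes "t \<ge> 1"
  shows "Measurable.pred (world d M \<rho>) (\<lambda>\<omega>. buys (lagging_market d M)
    (naive_belief (lagging_market d M) (fst \<omega>) (fst (snd \<omega>)) (snd (snd \<omega>)) t) (fst (snd \<omega>) t))"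
  using measurable_buys[of "world d M \<rho>" "\<lambda>s \<omega>. fst \<omega> s" d "\<lambda>s \<omega>. fst (snd \<omega>) s" "\<lambda>s \<omega>. snd (snd \<omega>) s" t M]
    measurable_world world_path_cube assms by blast

text \<open>Needed for monotonicity of the Bochner integral, which is 0 by default for
  non-integrable functions.\<close>

lemma integrable_world_loss:
  assumes t: "t \<ge> 1"
  shows "integrable (world d M \<rho>) (world_loss d M t)"
proof -
  let ?A = "lagging_market d M"
  interpret W: prob_space "world d M \<rho>"
  proof -
    have "prob_space (PiM {1::nat..} (\<lambda>_. pref_law ?A))" "prob_space (PiM {1::nat..} (\<lambda>_. noise_law ?A))"
      by (rule prob_space_pref_seq, rule prob_space_noise_seq)
    then show "prob_space (world d M \<rho>)"
      unfolding world_def by (intro prob_space_pair prob_space_path_law)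
  qed
  have reward: "(\<lambda>\<omega>. reward ?A (fst \<omega> t) (fst (snd \<omega>) t)) \<in> borel_measurable (world d M \<rho>)"
    unfolding lagging_market_sel
    using measurable_world(1,2)[OF t] by measurable
  have meas: "world_loss d M t \<in> borel_measurable (world d M \<rho>)"
    unfolding world_loss_def[abs_def] naive_utility_def of_bool_def
    by (intro borel_measurable_diff borel_measurable_max borel_measurable_times measurable_If
        reward measurable_const measurable_world_buys[OF t, unfolded pred_def]) simp_all
  have "norm (world_loss d M t \<omega>) \<le> 1 + \<bar>M\<bar> * real d" if \<omega>: "\<omega> \<in> space (world d M \<rho>)" for \<omega>
  proof -
    have q: "fst \<omega> t \<in> cube d" using \<omega> t by (rule world_path_cube)
    have "0 \<le> (\<Sum>i=1..d. fst \<omega> t i)" "(\<Sum>i=1..d. fst \<omega> t i) \<le> real d"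
      using cube_bit[OF q] sum_mono[of "{1..d}" "fst \<omega> t" "\<lambda>_. 1"] by (force intro!: sum_nonneg)+
    then have "\<bar>(\<Sum>i=1..d. fst \<omega> t i) - 7/8 * real d\<bar> \<le> real d" by simp
    then have "\<bar>M * ((\<Sum>i=1..d. fst \<omega> t i) - 7/8 * real d)\<bar> \<le> \<bar>M\<bar> * real d"
      unfolding abs_mult by (intro mult_left_mono) auto
    then have r: "\<bar>reward ?A (fst \<omega> t) (fst (snd \<omega>) t)\<bar> \<le> 1 + \<bar>M\<bar> * real d"
      by simp
    have "\<bar>max r 0 - r * of_bool b\<bar> \<le> \<bar>r\<bar>" for r :: real and b
      by (cases b) auto
    then have "\<bar>world_loss d M t \<omega>\<bar> \<le> \<bar>reward ?A (fst \<omega> t) (fst (snd \<omega>) t)\<bar>"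
      unfolding world_loss_def naive_utility_def .
    with r show ?thesis by (simp only: real_norm_def)
  qed
  then show ?thesis
    by (intro W.integrable_const_bound[OF AE_I2] meas)
qed

text \<open>\<open>S\<close> collects seeds whose chain is already in the best state while at least
  half of the components have a mostly bad past. Given such a seed, a low type comes and refuses
  with probability at least 1/14, forgoing M (d - 7d/8) = Md/8; the product of the two factors is
  Md/112.\<close>

lemma loss_at_time:
  assumes M: "M > 0" and d: "d \<ge> 1" and t: "t \<ge> 1"
    and S: "\<And>x. x \<in> S \<Longrightarrow> jump_path d x t = ones d"
      "\<And>x. x \<in> S \<Longrightarrow> d \<le> 2 * card {i \<in> {1..d}.
         6 * card {s \<in> {1..<t}. jump_path d x s i \<noteq> 0} \<le> card {s \<in> {1..<t}. jump_path d x s i = 0}}"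
  shows "M * real d / 112 * measure (seed_law d \<rho>) S \<le> (\<integral>\<omega>. world_loss d M t \<omega> \<partial>world d M \<rho>)"
proof -
  let ?A = "lagging_market d M"
  let ?P = "PiM {1::nat..} (\<lambda>_. pref_law ?A)" and ?N = "PiM {1::nat..} (\<lambda>_. noise_law ?A)"
  let ?R = "?P \<Otimes>\<^sub>M ?N"
  let ?B = "\<lambda>p w. buys ?A (naive_belief ?A p (fst w) (snd w) t) (fst w t)"
  have ps: "prob_space ?P" "prob_space ?N"
    by (rule prob_space_pref_seq, rule prob_space_noise_seq)
  interpret R: prob_space ?R using ps by (rule prob_space_pair)
  interpret W: prob_space "world d M \<rho>"
    unfolding world_def by (intro prob_space_pair prob_space_path_law R.prob_space_axioms)
  \<comment> \<open>On the cube a component sum of \<open>d\<close> singles out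
    \<open>ones d\<close>, and it is a measurable condition on coordinates.\<close>
  define E where "E = {\<omega> \<in> space (world d M \<rho>). (\<Sum>i=1..d. fst \<omega> t i) = real d \<and> fst (snd \<omega>) t = 0
      \<and> \<not> ?B (fst \<omega>) (snd \<omega>)}"
  have E[measurable]: "E \<in> sets (world d M \<rho>)"
  proof -
    have "Measurable.pred (world d M \<rho>) (\<lambda>\<omega>. (\<Sum>i=1..d. fst \<omega> t i) = real d)"
      "Measurable.pred (world d M \<rho>) (\<lambda>\<omega>. fst (snd \<omega>) t = 0)"
      using measurable_world(1,2)[OF t] by measurable
    then show ?thesis
      unfolding E_def using measurable_world_buys[OF t, of d M \<rho>]
      unfolding pred_def by (intro sets.sets_Collect_conj sets.sets_Collect_neg)
  qed
  have loss: "M * real d / 8 * indicator E \<omega> \<le> world_loss d M t \<omega>" for \<omega>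
  proof (cases "\<omega> \<in> E")
    case True
    then have "(\<Sum>i=1..d. fst \<omega> t i) = real d \<and> fst (snd \<omega>) t = 0 \<and> \<not> ?B (fst \<omega>) (snd \<omega>)"
      unfolding E_def mem_Collect_eq by (rule conjunct2)
    then have E\<omega>: "(\<Sum>i=1..d. fst \<omega> t i) = real d" "fst (snd \<omega>) t = 0" "\<not> ?B (fst \<omega>) (snd \<omega>)"
      by - (elim conjE, assumption)+
    have "naive_utility ?A (fst \<omega>) (fst (snd \<omega>)) (snd (snd \<omega>)) t = 0"
      unfolding naive_utility_def using E\<omega>(3) by (simp only: of_bool_eq mult_zero_right)
    moreover have "reward ?A (fst \<omega> t) (fst (snd \<omega>) t) = M * real d / 8"
      by (simp add: E\<omega>(1,2))
    ultimately show ?thesis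
      using True by (simp add: world_loss_def del: lagging_market_sel)
  qed (simp add: world_loss_nonneg)
  \<comment> \<open>Fubini: given the seed only preferences and noises are random, and the section
    of \<open>E\<close> contains the refusal event bounded in
    \<open>no_purchase_probability\<close>.\<close>
  have "ennreal (1/14) * indicator S x \<le> emeasure ?R (Pair (jump_path d x) -` E)" for x
  proof (cases "x \<in> S")
    case True
    interpret lagging_path d M "jump_path d x" by unfold_locales (rule jump_path_cube)
    have sub: "{w \<in> space ?R. fst w t = 0 \<and> \<not> ?B (jump_path d x) w} \<subseteq> Pair (jump_path d x) -` E"
      using S(1)[OF True] jump_path_space[of d x]
      by (auto simp: E_def world_def space_pair_measure path_law_def ones_def simp del: jump_path.simps)
    have "ennreal (1/14) \<le> emeasure ?R {w \<in> space ?R. fst w t = 0 \<and> \<not> ?B (jump_path d x) w}"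
      using S(2)[OF True] by (intro no_purchase_probability M d t) (simp only: zeros_def nonzeros_def)
    also have "\<dots> \<le> emeasure ?R (Pair (jump_path d x) -` E)"
      using E by (intro emeasure_mono sub) (auto simp: world_def)
    finally show ?thesis using True by simp
  qed simp
  then have "(\<integral>\<^sup>+x. ennreal (1/14) * indicator S x \<partial>seed_law d \<rho>) \<le>
      (\<integral>\<^sup>+x. emeasure ?R (Pair (jump_path d x) -` E) \<partial>seed_law d \<rho>)"
    by (intro nn_integral_mono) auto
  also have "\<dots> = (\<integral>\<^sup>+p. emeasure ?R (Pair p -` E) \<partial>path_law d \<rho>)"
  proof -
    have "(\<lambda>p. emeasure ?R (Pair p -` E)) \<in> borel_measurable (path_law d \<rho>)"
      using E unfolding world_def by (rule R.measurable_emeasure_Pair)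
    then show ?thesis
      unfolding path_law_def
      by (subst nn_integral_distr[OF measurable_jump_path]) (simp_all only: measurable_distr_eq1)
  qed
  also have "\<dots> = emeasure (world d M \<rho>) E"
    using E unfolding world_def by (rule R.emeasure_pair_measure_alt[symmetric])
  also have "(\<integral>\<^sup>+x. ennreal (1/14) * indicator S x \<partial>seed_law d \<rho>) = ennreal (1/14 * measure (seed_law d \<rho>) S)"
    by (subst nn_integral_cmult_indicator)
      (simp_all add: measure_pmf.emeasure_eq_measure ennreal_mult'[symmetric] del: ennreal_numeral)
  finally have "1/14 * measure (seed_law d \<rho>) S \<le> W.prob E"
    unfolding W.emeasure_eq_measure by (subst (asm) ennreal_le_iff) auto
  then have "M * real d / 8 * (1/14 * measure (seed_law d \<rho>) S) \<le> M * real d / 8 * W.prob E"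
    using M by (intro mult_left_mono) auto
  also have "\<dots> = (\<integral>\<omega>. M * real d / 8 * indicator E \<omega> \<partial>world d M \<rho>)"
    using E by (simp add: W.emeasure_eq_measure)
  also have "\<dots> \<le> (\<integral>\<omega>. world_loss d M t \<omega> \<partial>world d M \<rho>)"
    using E by (intro integral_mono loss integrable_world_loss t) (auto simp: W.emeasure_eq_measure)
  finally show ?thesis by simp
qed

section \<open>Probability of a bad start and a recent jump\<close>

definition low_quality :: "nat \<Rightarrow> vec set" where
  "low_quality d = {q \<in> cube d. d \<le> 2 * card {i \<in> {1..d}. q i = 0}}"

text \<open>Flipping all bits exchanges the states with at least half zeros and those with at least
  half ones. The two sets have equal size and cover the cube.\<close>

lemma prob_low_quality: "measure (pmf_of_set (cube d)) (low_quality d) \<ge> 1/2"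
proof -
  let ?H = "{q \<in> cube d. d \<le> 2 * card {i \<in> {1..d}. q i = 1}}"
  let ?f = "\<lambda>q. \<lambda>i\<in>{1..d}. 1 - q i :: real"
  have flip: "?f q \<in> cube d" "?f (?f q) = q" if "q \<in> cube d" for q
  proof -
    show "?f q \<in> cube d"
      unfolding cube_def restrict_PiE_iff using cube_bit[OF that] by fastforce
    show "?f (?f q) = q"
      using that by (auto simp: cube_def PiE_iff extensional_def fun_eq_iff)
  qed
  have zeros: "{i \<in> {1..d}. ?f q i = 0} = {i \<in> {1..d}. q i = 1}"
    and ones: "{i \<in> {1..d}. ?f q i = 1} = {i \<in> {1..d}. q i = 0}" for q
    by auto
  have "bij_betw ?f (low_quality d) ?H"
  proof (intro bij_betwI[where g = ?f] funcsetI)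
    fix q assume "q \<in> low_quality d"
    then have q: "q \<in> cube d" "d \<le> 2 * card {i \<in> {1..d}. q i = 0}" by (simp_all only: low_quality_def mem_Collect_eq)
    show "?f q \<in> ?H" unfolding mem_Collect_eq ones using flip(1)[OF q(1)] q(2) ..
    show "?f (?f q) = q" using q(1) by (rule flip(2))
  next
    fix q assume "q \<in> ?H"
    then have q: "q \<in> cube d" "d \<le> 2 * card {i \<in> {1..d}. q i = 1}" by (simp_all only: mem_Collect_eq)
    show "?f q \<in> low_quality d" unfolding low_quality_def mem_Collect_eq zeros using flip(1)[OF q(1)] q(2) ..
    show "?f (?f q) = q" using q(1) by (rule flip(2))
  qed
  then have card: "card ?H = card (low_quality d)" by (simp add: bij_betw_same_card)
  have "cube d \<subseteq> low_quality d \<union> ?H"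
  proof
    fix q assume q: "q \<in> cube d"
    have "{1..d} = {i \<in> {1..d}. q i = 0} \<union> {i \<in> {1..d}. q i = 1}"
      using cube_bit[OF q] by blast
    then have "d \<le> card {i \<in> {1..d}. q i = 0} + card {i \<in> {1..d}. q i = 1}"
      by (metis card_Un_le card_atLeastAtMost diff_Suc_1 One_nat_def)
    then show "q \<in> low_quality d \<union> ?H" using q by (auto simp: low_quality_def)
  qed
  then have "card (cube d) \<le> card (low_quality d \<union> ?H)"
    by (intro card_mono) (auto simp: low_quality_def)
  also have "\<dots> \<le> 2 * card (low_quality d)"
    using card_Un_le[of "low_quality d" ?H] card by simp
  finally have "real (card (cube d)) \<le> 2 * real (card (low_quality d))" by linarith
  moreover have "cube d \<inter> low_quality d = low_quality d" by (auto simp: low_quality_def)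
  ultimately show ?thesis
    by (simp add: measure_pmf_of_set divide_simps)
qed

text \<open>The window holds at least t/7 values of \<open>g\<close>, each of mass at least \<rho>/2
  because (1 - \<rho>)^T \<ge> 1 - \<rho> T \<ge> 1/2. The independent bad start contributes another
  1/2.\<close>

lemma prob_low_quality_jump:
  assumes \<rho>: "0 < \<rho>" "\<rho> < 1" and t: "t \<ge> 2" "t \<le> T" and \<rho>T: "\<rho> * real T \<le> 1/2"
    and k: "7 * k < t" "t \<le> 7 * (k + 1)"
  shows "real t * \<rho> / 28 \<le> measure (seed_law d \<rho>) (low_quality d \<times> {t - 2 - k..t - 2})"
proof -
  let ?J = "{t - 2 - k..t - 2}"
  \<comment> \<open>Ensures that \<open>t - 2 - k\<close> is not truncated, so that the window has
    exactly \<open>k + 1\<close> elements.\<close>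
  have "k \<le> t - 2" using t k by linarith
  then have card: "card ?J = k + 1" unfolding card_atLeastAtMost by linarith
  have "real t / 7 \<le> real (card ?J)"
    using k(2) of_nat_mono[of t "7 * (k + 1)", where 'a = real] unfolding card by simp
  then have "real t / 7 * (\<rho> / 2) \<le> real (card ?J) * (\<rho> / 2)"
    using \<rho> by (intro mult_right_mono) auto
  also have "\<dots> = (\<Sum>g\<in>?J. \<rho> / 2)" by simp
  also have "\<dots> \<le> (\<Sum>g\<in>?J. pmf (geometric_pmf \<rho>) g)"
  proof (intro sum_mono)
    fix g assume g: "g \<in> ?J"
    have "1/2 \<le> 1 + real T * (- \<rho>)" using \<rho>T by (simp add: mult.commute)
    also have "\<dots> \<le> (1 - \<rho>) ^ T"
      using Bernoulli_inequality[of "- \<rho>" T] \<rho> by simp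
    also have "\<dots> \<le> (1 - \<rho>) ^ g"
      using g t \<rho> by (intro power_decreasing) auto
    finally show "\<rho> / 2 \<le> pmf (geometric_pmf \<rho>) g"
      using \<rho> by simp
  qed
  also have "\<dots> = measure (geometric_pmf \<rho>) ?J"
    by (rule measure_measure_pmf_finite[symmetric]) simp
  finally have "real t / 7 * (\<rho> / 2) \<le> measure (geometric_pmf \<rho>) ?J" .
  with prob_low_quality[of d]
  have "1/2 * (real t / 7 * (\<rho> / 2)) \<le> measure (pmf_of_set (cube d)) (low_quality d) * measure (geometric_pmf \<rho>) ?J"
    using \<rho> by (intro mult_mono) auto
  also have "\<dots> = measure (seed_law d \<rho>) (low_quality d \<times> ?J)"
    unfolding seed_law_def
    by (subst measure_pmf_prob_product) (auto simp: low_quality_def intro: countable_finite)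
  finally show ?thesis by simp
qed

lemma loss_after_jump:
  assumes M: "M > 0" and d: "d \<ge> 1" and \<rho>: "0 < \<rho>" "\<rho> < 1"
    and t: "t \<ge> 2" "t \<le> T" and \<rho>T: "\<rho> * real T \<le> 1/2"
  shows "M * real d * \<rho> / 3136 * real t \<le> (\<integral>\<omega>. world_loss d M t \<omega> \<partial>world d M \<rho>)"
proof -
  \<comment> \<open>The largest \<open>k\<close> with \<open>7 * k < t\<close>: one seventh of the
    past, matching the ratio of six bad periods to one good period.\<close>
  define k r where "k = (t - 1) div 7" and "r = (t - 1) mod 7"
  have "7 * k + r = t - 1" unfolding k_def r_def by (rule mult_div_mod_eq)
  then have "t = 7 * k + r + 1" using t by simp
  moreover have "r < 7" by (simp add: r_def)
  ultimately have k: "7 * k < t" "t \<le> 7 * (k + 1)" by simp_all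
  let ?S = "low_quality d \<times> {t - 2 - k..t - 2}"
  have "M * real d / 112 * (real t * \<rho> / 28) \<le> M * real d / 112 * measure (seed_law d \<rho>) ?S"
    using M by (intro mult_left_mono prob_low_quality_jump[OF \<rho> t \<rho>T k]) auto
  also have "\<dots> \<le> (\<integral>\<omega>. world_loss d M t \<omega> \<partial>world d M \<rho>)"
  proof (rule loss_at_time[OF M d])
    show "t \<ge> 1" using t by simp
  next
    fix x assume "x \<in> ?S"
    then show "jump_path d x t = ones d" using t by (cases x) auto
  next
    fix x assume x: "x \<in> ?S"
    then obtain q g where x_eq: "x = (q, g)" and q: "q \<in> low_quality d"
      and g: "t - 2 - k \<le> g" "g \<le> t - 2"
      by (cases x) auto
    \<comment> \<open>The chain spends the \<open>g + 1\<close> periods 1 to g + 1 in the old state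
      and \<open>t - 2 - g \<le> k\<close> periods before \<open>t\<close> in the new one, while
      \<open>g + 1 \<ge> t - 1 - k \<ge> 6 * k\<close>.\<close>
    have lag: "6 * (t - 2 - g) \<le> g + 1" using g t k by linarith
    let ?Z = "{i \<in> {1..d}. q i = 0}"
    have "6 * card {s \<in> {1..<t}. jump_path d x s i \<noteq> 0} \<le> card {s \<in> {1..<t}. jump_path d x s i = 0}"
      if i: "i \<in> ?Z" for i
    proof -
      have state: "jump_path d x s i = (if s < g + 2 then 0 else 1)" if "s \<in> {1..<t}" for s
        using that i q by (auto simp: x_eq low_quality_def ones_def)
      have "{s \<in> {1..<t}. jump_path d x s i \<noteq> 0} = {g + 2..<t}"
        by (auto simp: state simp del: jump_path.simps split: if_splits)
      moreover have "{s \<in> {1..<t}. jump_path d x s i = 0} = {1..<g + 2}"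
        using g t by (auto simp: state simp del: jump_path.simps split: if_splits)
      ultimately show ?thesis using lag by simp
    qed
    then have "?Z \<subseteq> {i \<in> {1..d}. 6 * card {s \<in> {1..<t}. jump_path d x s i \<noteq> 0} \<le> card {s \<in> {1..<t}. jump_path d x s i = 0}}"
      by blast
    then have "card ?Z \<le> card {i \<in> {1..d}. 6 * card {s \<in> {1..<t}. jump_path d x s i \<noteq> 0} \<le> card {s \<in> {1..<t}. jump_path d x s i = 0}}"
      by (rule card_mono[rotated]) simp
    then show "d \<le> 2 * card {i \<in> {1..d}. 6 * card {s \<in> {1..<t}. jump_path d x s i \<noteq> 0} \<le> card {s \<in> {1..<t}. jump_path d x s i = 0}}"
      using q by (simp add: low_quality_def del: jump_path.simps)
  qed
  finally show ?thesis by (simp add: mult_ac)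
qed

section \<open>Summation over time and choice of the jump rate\<close>

lemma world_regret_nonneg: "world_regret d M \<rho> T \<ge> 0"
  unfolding world_regret_eq by (intro sum_nonneg world_loss_integral_nonneg)

lemma world_regret_ge:
  assumes M: "M > 0" and d: "d \<ge> 1" and \<rho>: "0 < \<rho>" "\<rho> < 1" and T: "T \<ge> 2" and \<rho>T: "\<rho> * real T \<le> 1/2"
  shows "M * real d * \<rho> * (real T)\<^sup>2 / 6272 \<le> world_regret d M \<rho> T"
proof -
  \<comment> \<open>The sum is T(T + 1)/2 - 1, since no jump is possible before time 2; it is at
    least T^2/2 from T = 2 on.\<close>
  have "(real T)\<^sup>2 / 2 \<le> (\<Sum>t=2..T. real t)"
    using T
  proof (induction T rule: dec_induct)
    case (step n)
    then show ?case by (simp add: power2_eq_square algebra_simps)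
  qed simp
  then have "M * real d * \<rho> / 3136 * ((real T)\<^sup>2 / 2) \<le> M * real d * \<rho> / 3136 * (\<Sum>t=2..T. real t)"
    using M \<rho> by (intro mult_left_mono) auto
  also have "\<dots> = (\<Sum>t=2..T. M * real d * \<rho> / 3136 * real t)"
    by (rule sum_distrib_left)
  also have "\<dots> \<le> (\<Sum>t=2..T. \<integral>\<omega>. world_loss d M t \<omega> \<partial>world d M \<rho>)"
    using assms by (intro sum_mono loss_after_jump) auto
  also have "\<dots> \<le> world_regret d M \<rho> T"
    unfolding world_regret_eq by (intro sum_mono2 world_loss_integral_nonneg) auto
  finally show ?thesis by simp
qed

text \<open>At time 1 the history is empty, so every component lags by 0 \<le> 0 and the prior alone
  deters low types. The best state as initial state costs the factor 2^d.\<close>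

lemma world_regret_first:
  assumes M: "M > 0" and d: "d \<ge> 1"
  shows "M * real d / (112 * 2 ^ d) \<le> world_regret d M \<rho> 1"
proof -
  have "M * real d / 112 * measure (seed_law d \<rho>) ({ones d} \<times> UNIV) \<le> (\<integral>\<omega>. world_loss d M 1 \<omega> \<partial>world d M \<rho>)"
    by (rule loss_at_time[OF M d]) (auto simp del: atLeastAtMost_iff)
  then show ?thesis
    by (simp add: prob_seed_Times world_regret_eq)
qed

text \<open>The market is fixed before \<open>T\<close> and \<eta>; only the jump rate varies, and
  it depends on \<open>T\<close> and \<open>C\<close> but not on \<eta>. For M = 0 the bound reduces
  to nonnegativity of the regret, so the estimate is required for M > 0 only.\<close>

lemma naive_lower_boundI:
  assumes d: "d \<ge> 1" and M: "M \<ge> 0" and c: "c > 0" and C: "C > 0"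
    and S: "\<And>T \<eta>. (T, \<eta>) \<in> S \<Longrightarrow> T \<ge> 1 \<and> 0 < \<eta> \<and> \<eta> < 1 \<and> 1 \<le> C * (\<eta> * real T)"
    and regret: "\<And>T \<eta>. (T, \<eta>) \<in> S \<Longrightarrow> M > 0 \<Longrightarrow>
      M * real d * real T \<le> c * world_regret d M (min (1/2) (1/C) / real T) T"
  shows "naive_lower_bound d M c S"
  unfolding naive_lower_bound_def
proof (intro exI[of _ "lagging_market d M"] conjI)
  show "quality_dim (lagging_market d M) = d" by simp
  show "valid_market (lagging_market d M)" using d by (rule lagging_market_valid)
  show "lipschitz_reward M (lagging_market d M)" using M by (rule lagging_market_lipschitz)
  show "purchase_guarantee (lagging_market d M)" using M by (rule lagging_market_purchase_guarantee)
  show "identifiable (lagging_market d M)" using d by (rule lagging_market_identifiable)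
  show "\<forall>(T, \<eta>)\<in>S. \<exists>P. transition_matrix d P \<and> (\<forall>q\<in>cube d. P q q \<ge> 1 - \<eta>) \<and>
     (\<exists>(\<Omega> :: ((nat \<Rightarrow> vec) \<times> (nat \<Rightarrow> real) \<times> (nat \<Rightarrow> vec)) measure) Q \<theta> \<epsilon>.
        market_dynamics (lagging_market d M) P \<Omega> Q \<theta> \<epsilon> \<and>
        naive_update_defined (lagging_market d M) \<Omega> Q \<theta> \<epsilon> \<and>
        M * real d * real T \<le> c * naive_regret (lagging_market d M) \<Omega> Q \<theta> \<epsilon> T)"
  proof (clarify, goal_cases)
    case (1 T \<eta>)
    define \<rho> where "\<rho> = min (1/2) (1/C) / real T"
    have T: "T \<ge> 1" and \<eta>: "0 < \<eta>" "1 \<le> C * (\<eta> * real T)" using S[OF 1] by auto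
    have \<rho>: "0 < \<rho>" using C T by (auto simp: \<rho>_def)
    have "\<rho> \<le> (1/2) / 1" unfolding \<rho>_def using T C by (intro frac_le) auto
    then have \<rho>1: "\<rho> < 1" by simp
    have "\<rho> \<le> (1/C) / real T" unfolding \<rho>_def using T by (intro divide_right_mono) auto
    also have "\<dots> \<le> \<eta>" using \<eta> C T by (simp add: field_simps)
    finally have \<rho>\<eta>: "\<rho> \<le> \<eta>" .
    have "M * real d * real T \<le> c * world_regret d M \<rho> T"
    proof (cases "M = 0")
      case True
      then show ?thesis using c world_regret_nonneg by simp
    next
      case False
      then show ?thesis using M regret[OF 1] by (simp add: \<rho>_def)
    qed
    then show ?case
      using jump_matrix_transition[OF \<rho> \<rho>1] jump_matrix_diag[of \<rho> d] \<rho> \<rho>\<eta>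
        world_dynamics[OF \<rho> \<rho>1] world_naive_update_defined
      unfolding world_regret_def
      by (intro exI[of _ "jump_matrix d \<rho>"] conjI exI[of _ "world d M \<rho>"] exI[of _ "\<lambda>t \<omega>. fst \<omega> t"]
          exI[of _ "\<lambda>t \<omega>. fst (snd \<omega>) t"] exI[of _ "\<lambda>t \<omega>. snd (snd \<omega>) t"])
        (auto intro: order_trans[OF diff_left_mono])
  qed
qed

lemma world_regret_linear:
  assumes "M > 0" "d \<ge> 1" "T \<ge> 2" and \<kappa>: "0 < \<kappa>" "\<kappa> \<le> 1/2"
  shows "M * real d * real T \<le> 6272 / \<kappa> * world_regret d M (\<kappa> / real T) T"
proof -
  have "\<kappa> / real T \<le> (1/2) / 1" using assms by (intro frac_le) auto
  then have "M * real d * (\<kappa> / real T) * (real T)\<^sup>2 / 6272 \<le> world_regret d M (\<kappa> / real T) T"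
    using assms by (intro world_regret_ge) auto
  then show ?thesis
    using assms by (simp add: field_simps power2_eq_square)
qed

theorem theorem5p1:
  fixes S :: "(nat \<times> real) set"
  assumes range: "\<forall>(T, \<eta>)\<in>S. T \<ge> 1 \<and> 0 < \<eta> \<and> \<eta> < 1"
    and etaT: "\<exists>C>0. \<forall>(T, \<eta>)\<in>S. 1 \<le> C * (\<eta> * real T)"
  shows "(\<forall>d\<ge>1. \<forall>M\<ge>0. \<exists>c>0. naive_lower_bound d M c S) \<and>
         (\<exists>c>0. \<forall>d\<ge>1. \<forall>M\<ge>0. naive_lower_bound d M c {(T, \<eta>)\<in>S. T \<ge> 2})"
proof -
  obtain C where C: "C > 0" and etaC: "\<forall>(T, \<eta>)\<in>S. 1 \<le> C * (\<eta> * real T)"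
    using etaT by blast
  define \<kappa> where "\<kappa> = min (1/2) (1/C)"
  have \<kappa>: "0 < \<kappa>" "\<kappa> \<le> 1/2" using C by (auto simp: \<kappa>_def)
  have S: "T \<ge> 1 \<and> 0 < \<eta> \<and> \<eta> < 1 \<and> 1 \<le> C * (\<eta> * real T)" if "(T, \<eta>) \<in> S" for T \<eta>
    using range etaC that by blast
  \<comment> \<open>One constant for both regimes: the first entry handles T \<ge> 2, the second T =
    1.\<close>
  have "naive_lower_bound d M (max (6272 / \<kappa>) (112 * 2 ^ d)) S" if d: "d \<ge> 1" and M: "M \<ge> 0" for d M
  proof (rule naive_lower_boundI[OF d M _ C S])
    show "0 < max (6272 / \<kappa>) (112 * 2 ^ d)" using \<kappa> by (simp add: less_max_iff_disj)
  next
    fix T \<eta> assume "(T, \<eta>) \<in> S" and M: "M > 0"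
    then have T: "T \<ge> 1" using S by blast
    have le: "c * world_regret d M (\<kappa> / real T) T \<le> max (6272 / \<kappa>) (112 * 2 ^ d) * world_regret d M (\<kappa> / real T) T"
      if "c \<le> max (6272 / \<kappa>) (112 * 2 ^ d)" for c
      using that by (intro mult_right_mono world_regret_nonneg)
    have "\<exists>c\<le>max (6272 / \<kappa>) (112 * 2 ^ d). M * real d * real T \<le> c * world_regret d M (\<kappa> / real T) T"
    proof (cases "T = 1")
      case True
      have "M * real d \<le> 112 * 2 ^ d * world_regret d M \<kappa> 1"
        using world_regret_first[OF M d, of \<kappa>] by (simp add: field_simps)
      with True show ?thesis by (intro exI[of _ "112 * 2 ^ d"]) simp
    next
      case False
      with T have "T \<ge> 2" by simp
      from world_regret_linear[OF M d this \<kappa>] show ?thesis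
        by (intro exI[of _ "6272 / \<kappa>"]) simp
    qed
    then show "M * real d * real T \<le> max (6272 / \<kappa>) (112 * 2 ^ d) * world_regret d M (min (1/2) (1/C) / real T) T"
      unfolding \<kappa>_def[symmetric] using le order_trans by blast
  qed
  moreover have "0 < max (6272 / \<kappa>) (112 * 2 ^ d)" for d :: nat
    using \<kappa> by (simp add: less_max_iff_disj)
  \<comment> \<open>Without T = 1 the constant depends on \<open>C\<close> alone, hence is uniform
    in \<open>d\<close> and \<open>M\<close>.\<close>
  moreover have "naive_lower_bound d M (6272 / \<kappa>) {(T, \<eta>)\<in>S. T \<ge> 2}" if d: "d \<ge> 1" and M: "M \<ge> 0" for d M
  proof (rule naive_lower_boundI[OF d M _ C])
    fix T \<eta> assume "(T, \<eta>) \<in> {(T, \<eta>)\<in>S. T \<ge> 2}" and M: "M > 0"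
    then show "M * real d * real T \<le> 6272 / \<kappa> * world_regret d M (min (1/2) (1/C) / real T) T"
      unfolding \<kappa>_def[symmetric] using d \<kappa> by (intro world_regret_linear) auto
  qed (use S \<kappa> in auto)
  moreover have "0 < 6272 / \<kappa>" using \<kappa> by simp
  ultimately show ?thesis by blast
qed

end
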